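(* Let $\delta \ge 0$ and let $G$ be a finite connected $\delta$-hyperbolic graph, and let $k \ge 1$ be an integer. Then there is a polynomial-time algorithm that, given $G$ and $k$, outputs a collection $\mathcal{C}$ of $k$ isometric paths of $G$ such that $\max_{v\in V(G)} d(v,\bigcup_{P\in\mathcal{C}}V(P)) \le R^*_k + O(\delta)$, where $R^*_k$ is the optimum value of $k$-Geodesic Center on $G$. That is, there is a polynomial-time additive $O(\delta)$-approximation algorithm for $k$-Geodesic Center on $G$.
   Context: All graphs are finite, connected, unweighted, with the shortest-path metric $d=d_G$. An isometric path is a shortest path between its end-vertices. For sets $S_1,S_2$ of vertices, $d(S_1,S_2)=\min\{d(u,v): u\in S_1, v\in S_2\}$. Problem $k$-Geodesic Center: given $G$ and an integer $k\ge 1$, find a collection $\mathcal{C}$ of $k$ isometric paths minimising the eccentricity $\max_{v\in V(G)} d(v,\bigcup_{P\in\mathcal{C}}V(P))$; the minimum value is denoted $R^*_k$. An algorithm is an additive $\alpha$-approximation algorithm if it runs in polynomial time and always outputs a feasible solution whose value is at most the optimum plus $\alpha$. The Gromov product of $x,y$ with respect to $z$ is $(x|y)_z=\frac12(d(x,z)+d(z,y)-d(x,y))$. A graph $G$ is $\delta$-hyperbolic if for all vertices $u,v,w,x$: $(u|w)_x \ge \min\{(u|v)_x,(v|w)_x\}-\delta$. *)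

theory Defs
  imports Complex_Main "HOL-Computational_Algebra.Polynomial" "Graph_Theory.Graph_Theory"
begin

section \<open>Metric notions on graphs\<close>

text \<open>Finite simple graphs are the library's \<open>pair_graph\<close>s, paths are vertex lists (\<open>vpath\<close>).
  The functions below are meaningful for connected graphs only, where every \<open>LEAST\<close>, \<open>Min\<close>,
  \<open>Max\<close> and \<open>INF\<close> ranges over a nonempty set.\<close>

definition gdist :: "'a pair_pre_digraph \<Rightarrow> 'a \<Rightarrow> 'a \<Rightarrow> nat" where
  "gdist G u v = (LEAST l. \<exists>p. vwalk p (with_proj G) \<and> hd p = u \<and> last p = v \<and> vwalk_length p = l)"

definition set_gdist :: "'a pair_pre_digraph \<Rightarrow> 'a set \<Rightarrow> 'a set \<Rightarrow> nat" where
  "set_gdist G S T = Min {gdist G u v |u v. u \<in> S \<and> v \<in> T}"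

definition isometric_path :: "'a pair_pre_digraph \<Rightarrow> 'a list \<Rightarrow> bool" where
  "isometric_path G p \<longleftrightarrow> vpath p (with_proj G) \<and> vwalk_length p = gdist G (hd p) (last p)"

definition gromov_product :: "'a pair_pre_digraph \<Rightarrow> 'a \<Rightarrow> 'a \<Rightarrow> 'a \<Rightarrow> real" where
  "gromov_product G x y z = (real (gdist G x z) + real (gdist G z y) - real (gdist G x y)) / 2"

definition hyperbolic :: "real \<Rightarrow> 'a pair_pre_digraph \<Rightarrow> bool" where
  "hyperbolic \<delta> G \<longleftrightarrow>
    (\<forall>u\<in>pverts G. \<forall>v\<in>pverts G. \<forall>w\<in>pverts G. \<forall>x\<in>pverts G.
      gromov_product G u w x \<ge> min (gromov_product G u v x) (gromov_product G v w x) - \<delta>)"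


section \<open>The problem k-Geodesic Center\<close>

text \<open>A collection of \<open>k\<close> paths is a list of length \<open>k\<close>; repetitions are allowed, so that
  solutions exist for every \<open>k\<close>.\<close>

definition feasible :: "'a pair_pre_digraph \<Rightarrow> nat \<Rightarrow> 'a list list \<Rightarrow> bool" where
  "feasible G k Ps \<longleftrightarrow> length Ps = k \<and> (\<forall>P\<in>set Ps. isometric_path G P)"

definition eccentricity :: "'a pair_pre_digraph \<Rightarrow> 'a list list \<Rightarrow> nat" where
  "eccentricity G Ps = Max ((\<lambda>v. set_gdist G {v} (\<Union>P\<in>set Ps. set P)) ` pverts G)"

definition opt_radius :: "'a pair_pre_digraph \<Rightarrow> nat \<Rightarrow> nat" where
  "opt_radius G k = (INF Ps\<in>{Ps. feasible G k Ps}. eccentricity G Ps)"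


section \<open>Algorithms\<close>

text \<open>Algorithms are structured random access programs over natural numbers, with the usual
  big-step semantics of a while language, extended by a step count. A program variable is
  addressed by a name and a list of subscripts, so \<open>V x []\<close> is a scalar, \<open>V x [i]\<close> an array
  entry, and \<open>V x [i, j]\<close> a matrix entry.

  Every assignment and every test costs one step. This uniform cost measure is polynomially
  related to Turing machine time: the expressions occurring in a fixed program have bounded
  size, and as there are only addition and truncated subtraction, the bit length of the numbers
  grows by at most a constant (depending on the program) in each step.\<close>

type_synonym vname = string
type_synonym state = "vname \<Rightarrow> nat list \<Rightarrow> nat"

datatype aexp = N nat | V vname "aexp list" | Plus aexp aexp | Minus aexp aexp

datatype bexp = Less aexp aexp | Not bexp | And bexp bexp

datatype com =
    Skip
  | Assign vname "aexp list" aexp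
  | Seq com com
  | If bexp com com
  | While bexp com

fun aval :: "aexp \<Rightarrow> state \<Rightarrow> nat" where
  "aval (N n) s = n"
| "aval (V x es) s = s x (map (\<lambda>e. aval e s) es)"
| "aval (Plus a b) s = aval a s + aval b s"
| "aval (Minus a b) s = aval a s - aval b s"

fun bval :: "bexp \<Rightarrow> state \<Rightarrow> bool" where
  "bval (Less a b) s \<longleftrightarrow> aval a s < aval b s"
| "bval (Not b) s \<longleftrightarrow> \<not> bval b s"
| "bval (And a b) s \<longleftrightarrow> bval a s \<and> bval b s"

text \<open>\<open>exec c s t s'\<close>: started in state \<open>s\<close>, the program \<open>c\<close> halts after \<open>t\<close> steps in state \<open>s'\<close>.\<close>

inductive exec :: "com \<Rightarrow> state \<Rightarrow> nat \<Rightarrow> state \<Rightarrow> bool" where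
  Skip: "exec Skip s 1 s"
| Assign: "exec (Assign x es a) s 1 (s(x := (s x)(map (\<lambda>e. aval e s) es := aval a s)))"
| Seq: "exec c1 s t1 s1 \<Longrightarrow> exec c2 s1 t2 s2 \<Longrightarrow> exec (Seq c1 c2) s (t1 + t2) s2"
| IfTrue: "bval b s \<Longrightarrow> exec c1 s t s' \<Longrightarrow> exec (If b c1 c2) s (1 + t) s'"
| IfFalse: "\<not> bval b s \<Longrightarrow> exec c2 s t s' \<Longrightarrow> exec (If b c1 c2) s (1 + t) s'"
| WhileFalse: "\<not> bval b s \<Longrightarrow> exec (While b c) s 1 s"
| WhileTrue: "bval b s \<Longrightarrow> exec c s t1 s1 \<Longrightarrow> exec (While b c) s1 t2 s2 \<Longrightarrow>
    exec (While b c) s (1 + t1 + t2) s2"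

inductive_cases exec_elims:
  "exec Skip s t s'"
  "exec (Assign x es a) s t s'"
  "exec (Seq c1 c2) s t s'"
  "exec (If b c1 c2) s t s'"
  "exec (While b c) s t s'"

lemma exec_deterministic:
  "exec c s t s' \<Longrightarrow> exec c s u s'' \<Longrightarrow> u = t \<and> s'' = s'"
proof (induction arbitrary: u s'' rule: exec.induct)
  case (Skip s)
  then show ?case by (rule exec_elims(1)) simp
next
  case (Assign x es a s)
  then show ?case by (rule exec_elims(2)) simp
next
  case (Seq c1 s t1 s1 c2 t2 s2)
  from Seq.prems obtain v1 r v2 where "u = v1 + v2" "exec c1 s v1 r" "exec c2 r v2 s''"
    by (rule exec_elims(3))
  with Seq.IH(1)[of v1 r] Seq.IH(2)[of v2 s''] show ?case by simp
next
  case (IfTrue b s c1 t s' c2)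
  from IfTrue.prems show ?case
    by (rule exec_elims(4)) (use IfTrue.hyps(1) IfTrue.IH[of "u - 1" s''] in simp_all)
next
  case (IfFalse b s c2 t s' c1)
  from IfFalse.prems show ?case
    by (rule exec_elims(4)) (use IfFalse.hyps(1) IfFalse.IH[of "u - 1" s''] in simp_all)
next
  case (WhileFalse b s c)
  from WhileFalse.prems show ?case
    by (rule exec_elims(5)) (use WhileFalse.hyps in simp_all)
next
  case (WhileTrue b s c t1 s1 t2 s2)
  obtain v1 r v2 where
    "u = Suc (v1 + v2)" "exec c s v1 r" "exec (While b c) r v2 s''"
    by (rule exec_elims(5)[OF WhileTrue.prems]) (use WhileTrue.hyps(1) in auto)
  with WhileTrue.IH(1)[of v1 r] WhileTrue.IH(2)[of v2 s''] show ?case by simp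
qed


section \<open>Approximation algorithms for k-Geodesic Center\<close>

text \<open>In an instance given to an algorithm the vertices are numbered \<open>0, \<dots>, n - 1\<close>.\<close>

definition gc_instance :: "nat pair_pre_digraph \<Rightarrow> nat \<Rightarrow> bool" where
  "gc_instance G k \<longleftrightarrow>
    pair_graph G \<and> connected (with_proj G) \<and> pverts G = {..<card (pverts G)} \<and> k \<ge> 1"

text \<open>The graph is given by its adjacency matrix; all other memory cells are initially 0.\<close>

definition input_state :: "nat pair_pre_digraph \<Rightarrow> nat \<Rightarrow> state" where
  "input_state G k = (\<lambda>x is.
     if x = ''n'' \<and> is = [] then card (pverts G)
     else if x = ''k'' \<and> is = [] then k
     else if x = ''adj'' \<and> (\<exists>u v. is = [u, v] \<and> (u, v) \<in> parcs G) then 1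
     else 0)"

text \<open>The \<open>i\<close>-th path of the output consists of the first \<open>len[i]\<close> entries of row \<open>i\<close> of the
  matrix \<open>path\<close>.\<close>

definition output_paths :: "nat \<Rightarrow> state \<Rightarrow> nat list list" where
  "output_paths k s =
     map (\<lambda>i. map (\<lambda>j. s ''path'' [i, j]) [0..<s ''len'' [i]]) [0..<k]"

text \<open>As \<open>k\<close> paths have to be written, running times are measured in \<open>n + k\<close>.\<close>

definition polynomial_time :: "com \<Rightarrow> bool" where
  "polynomial_time c \<longleftrightarrow>
    (\<exists>p :: nat poly. \<forall>G k. gc_instance G k \<longrightarrow>
      (\<exists>t s. exec c (input_state G k) t s \<and> t \<le> poly p (card (pverts G) + k)))"

definition additive_approx_algorithm :: "com \<Rightarrow> nat pair_pre_digraph set \<Rightarrow> real \<Rightarrow> bool" where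
  "additive_approx_algorithm c \<G> \<alpha> \<longleftrightarrow>
    polynomial_time c \<and>
    (\<forall>G\<in>\<G>. \<forall>k. gc_instance G k \<longrightarrow>
      (\<exists>t s. exec c (input_state G k) t s \<and>
        feasible G k (output_paths k s) \<and>
        real (eccentricity G (output_paths k s)) \<le> real (opt_radius G k) + \<alpha>))"

end

theory Submission
  imports Defs
begin

text \<open>Write \<open>(x|y)\<^sub>z\<close> for the Gromov product, which up to \<open>O(\<delta>)\<close> is the distance of \<open>z\<close> from a
  geodesic between \<open>x\<close> and \<open>y\<close>. Let \<open>x\<^sub>0\<close> be farthest from an arbitrary vertex, and let each further
  point \<open>x\<^sub>i\<close> maximise \<open>min\<^sub>j (x\<^sub>0|x\<^sub>j)\<^sub>v\<close> over all vertices \<open>v\<close>, where \<open>j < i\<close>. If the last of the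
  \<open>2k + 1\<close> points \<open>x\<^sub>0, \<dots>, x\<^sub>2\<^sub>k\<close> attains the value \<open>r\<close>, then all Gromov products of three of these
  points are at least \<open>r - O(\<delta>)\<close>. As in a tree, a geodesic within distance \<open>R\<close> of three such points
  forces \<open>r \<le> R + O(\<delta>)\<close>; since some geodesic of an optimal solution serves three of the \<open>2k + 1\<close>
  points, \<open>r\<close> is at most the optimum plus \<open>O(\<delta>)\<close>.

  Conversely, every vertex \<open>v\<close> has \<open>(x\<^sub>0|x\<^sub>j)\<^sub>v \<le> r\<close> for some \<open>j < 2k\<close>. Pair up \<open>x\<^sub>0, \<dots>, x\<^sub>2\<^sub>k\<^sub>-\<^sub>1\<close> so
  that no exchange between two pairs increases the sum of the distances within the pairs; this is
  found by local search, the sum being at most \<open>kn\<close>. If both the pair of \<open>x\<^sub>0\<close> and the pair of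
  \<open>x\<^sub>j\<close> had a Gromov product above \<open>r + 2\<delta>\<close> at \<open>v\<close>, then exchanging partners would increase the sum.
  So \<open>v\<close> is within \<open>r + O(\<delta>) + 1/2\<close> of a geodesic joining some pair.

  The rounding error \<open>1/2\<close> is harmless: Gromov products are half-integers, so a \<open>\<delta>\<close>-hyperbolic graph
  with \<open>\<delta> < 1/2\<close> is \<open>0\<close>-hyperbolic, and the radii are integers.\<close>

section \<open>Hyperbolic metrics\<close>

text \<open>The Gromov-product inequality appears here doubled and rearranged into its symmetric
  form: of the three sums of opposite distances in a quadruple, each is at most the larger of the
  other two plus \<open>2 * \<delta>\<close>.\<close>

locale hyperbolic_space =
  fixes V :: "'a set" and d :: "'a \<Rightarrow> 'a \<Rightarrow> nat" and \<delta> :: real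
  assumes nonneg: "\<delta> \<ge> 0"
    and refl: "x \<in> V \<Longrightarrow> d x x = 0"
    and sym: "x \<in> V \<Longrightarrow> y \<in> V \<Longrightarrow> d x y = d y x"
    and tri: "x \<in> V \<Longrightarrow> y \<in> V \<Longrightarrow> z \<in> V \<Longrightarrow> d x z \<le> d x y + d y z"
    and four_point: "u \<in> V \<Longrightarrow> v \<in> V \<Longrightarrow> w \<in> V \<Longrightarrow> x \<in> V \<Longrightarrow>
      real (d u w + d v x) \<le> max (real (d u v + d w x)) (real (d v w + d u x)) + 2 * \<delta>"
begin

definition gp :: "'a \<Rightarrow> 'a \<Rightarrow> 'a \<Rightarrow> real" where
  "gp x y z = (real (d x z) + real (d z y) - real (d x y)) / 2"

lemma gp_commute: "x \<in> V \<Longrightarrow> y \<in> V \<Longrightarrow> z \<in> V \<Longrightarrow> gp x y z = gp y x z"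
  by (simp add: gp_def sym)

text \<open>In the tripod of \<open>x\<close>, \<open>y\<close>, \<open>z\<close> the two products
  are the lengths of the legs at \<open>z\<close> and at \<open>x\<close>, which together form the
  side between them.\<close>

lemma gp_add: "x \<in> V \<Longrightarrow> y \<in> V \<Longrightarrow> z \<in> V \<Longrightarrow> gp x y z + gp z y x = real (d z x)"
  by (simp add: gp_def sym field_simps)

lemma gp_hyperbolic:
  assumes "u \<in> V" "v \<in> V" "w \<in> V" "x \<in> V"
  shows "gp u w x \<ge> min (gp u v x) (gp v w x) - \<delta>"
  using four_point[OF assms] sym[of x w] sym[of x v] assms
  by (auto simp: gp_def min_def max_def field_simps split: if_splits)

text \<open>The point of the geodesic at the centre of the tripod \<open>a\<close>,
  \<open>b\<close>, \<open>v\<close> is close enough. A point \<open>w\<close> of the geodesic has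
  \<open>gp a b w = 0\<close>, so hyperbolicity makes \<open>gp a v w\<close> or
  \<open>gp v b w\<close> at most \<open>\<delta>\<close>, and either bound limits
  \<open>d v w\<close>.\<close>

lemma dist_geodesic_le:
  assumes V: "a \<in> V" "b \<in> V" "v \<in> V"
    and geodesic: "\<And>i. i \<le> d a b \<Longrightarrow> p i \<in> V \<and> d a (p i) = i \<and> d (p i) b = d a b - i"
  shows "\<exists>i\<le>d a b. real (d v (p i)) \<le> gp a b v + 2 * \<delta> + 1/2"
proof -
  \<comment> \<open>This is \<open>gp v b a\<close> rounded down; the rounding causes the
    \<open>1/2\<close>.\<close>
  define i where "i = (d a v + d a b - d v b) div 2"
  have t: "d v b \<le> d a v + d a b" "d a v \<le> d a b + d v b" "d a b \<le> d a v + d v b"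
    using V tri sym by metis+
  have i: "2 * i \<le> d a v + d a b - d v b" "d a v + d a b - d v b \<le> 2 * i + 1"
    unfolding i_def by simp_all
  have le: "i \<le> d a b"
    using t i by linarith
  define w where "w = p i"
  have w: "w \<in> V" "d a w = i" "d w b = d a b - i"
    using geodesic[OF le] by (simp_all add: w_def)
  have "gp a b w = 0"
    using w le by (simp add: gp_def)
  with gp_hyperbolic[of a v b w] V w(1) have "gp a v w \<le> \<delta> \<or> gp v b w \<le> \<delta>"
    by linarith
  then have "real (d v w) \<le> gp a b v + 2 * \<delta> + 1/2"
    using i t le w V sym[of v w] sym[of v b] sym[of w b] by (auto simp: gp_def field_simps)
  with le show ?thesis
    unfolding w_def by blast
qed

text \<open>\<open>swap\<close> says that \<open>gp a b v + gp a' b' v\<close> is at least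
  \<open>gp a a' v + gp b b' v\<close>. If both products on the right exceeded
  \<open>r + 2 * \<delta>\<close>, hyperbolicity would carry \<open>near\<close> over from
  \<open>a\<close>, \<open>b\<close> to \<open>a\<close>, \<open>b'\<close> and then to
  \<open>a'\<close>, \<open>b'\<close>, losing \<open>\<delta>\<close> each time, and the left side
  would be at most \<open>2 * r + 2 * \<delta>\<close>.\<close>

lemma gp_pairing:
  assumes V: "a \<in> V" "a' \<in> V" "b \<in> V" "b' \<in> V" "v \<in> V"
    and swap: "d a b + d a' b' \<le> d a a' + d b b'"
    and near: "gp a b v \<le> r"
  shows "gp a a' v \<le> r + 2 * \<delta> \<or> gp b b' v \<le> r + 2 * \<delta>"
proof (rule ccontr)
  assume "\<not> ?thesis"
  then have far: "gp a a' v > r + 2 * \<delta>" "gp b b' v > r + 2 * \<delta>"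
    by auto
  have "gp a b' v \<le> r + \<delta>"
    using gp_hyperbolic[of a b' b v] gp_commute[of b b' v] near far nonneg V by linarith
  then have "gp a' b' v \<le> r + 2 * \<delta>"
    using gp_hyperbolic[of a a' b' v] far nonneg V by linarith
  moreover have "real (d a b) + real (d a' b') \<le> real (d a a') + real (d b b')"
    using swap by linarith
  ultimately show False
    using far near nonneg sym[of v b] sym[of v a'] sym[of v b'] V by (simp add: gp_def)
qed

text \<open>Since \<open>q\<close> lies between \<open>p\<close> and \<open>s\<close>, the product
  \<open>gp p s b\<close> is at most \<open>R\<close>. Going from \<open>p\<close> over
  \<open>a\<close> and \<open>c\<close> to \<open>s\<close> loses \<open>2 * \<delta>\<close>, and
  the middle product \<open>gp a c b\<close> is too large to be the minimum, so
  \<open>gp p a b\<close> or \<open>gp c s b\<close> must be small.\<close>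

lemma three_points_on_geodesic:
  assumes V: "a \<in> V" "b \<in> V" "c \<in> V" "p \<in> V" "q \<in> V" "s \<in> V"
    and between: "d p s = d p q + d q s"
    and close: "real (d a p) \<le> R" "real (d b q) \<le> R" "real (d c s) \<le> R"
    and apart: "gp a c b > R + 2 * \<delta>" "gp b c a > R + 2 * \<delta>" "gp a b c > R + 2 * \<delta>"
  shows False
proof -
  have sum: "real (d a b) = gp b c a + gp a c b" "real (d c b) = gp a c b + gp a b c"
    using V sym by (simp_all add: gp_def field_simps)
  have t: "d p b \<le> d p q + d q b" "d b s \<le> d b q + d q s"
    "d a b \<le> d a p + d p b" "d c b \<le> d c s + d s b"
    using V by (simp_all add: tri)
  have "gp p s b \<le> R"
    using t close(2) between sym[of q b] V by (simp add: gp_def)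
  moreover have "gp p s b \<ge> min (gp p a b) (gp a s b) - \<delta>" "gp a s b \<ge> min (gp a c b) (gp c s b) - \<delta>"
    using gp_hyperbolic V by blast+
  ultimately have "gp p a b \<le> R + 2 * \<delta> \<or> gp c s b \<le> R + 2 * \<delta>"
    using apart(1) nonneg by linarith
  \<comment> \<open>\<open>gp p a b\<close> is at least \<open>d a b - d a p\<close>, and
    \<open>d a b\<close> is the sum of two products above \<open>R + 2 * \<delta>\<close>, so
    \<open>gp p a b\<close> is too large; likewise \<open>gp c s b\<close>.\<close>
  then show False
    using sum t close apart nonneg sym[of a p] sym[of a b] sym[of p b] sym[of c s] sym[of c b] sym[of b s] V
    by (auto simp: gp_def[of p a b] gp_def[of c s b])
qed

end

section \<open>Greedily chosen points: lower bound and covering radius\<close>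

text \<open>Greedily chosen points; \<open>gp (x 0) (x j) v\<close> approximates the distance of \<open>v\<close> to a geodesic
  from \<open>x 0\<close> to \<open>x j\<close>, and \<open>m i\<close> is the distance of \<open>x i\<close> to the tree spanned by its predecessors.\<close>

locale greedy_points = hyperbolic_space +
  fixes x :: "nat \<Rightarrow> 'a" and z :: 'a and K :: nat and m :: "nat \<Rightarrow> real"
  assumes x: "\<And>i. i \<le> K \<Longrightarrow> x i \<in> V" and z: "z \<in> V" and K: "K > 0"
    and farthest: "\<And>v. v \<in> V \<Longrightarrow> d z v \<le> d z (x 0)"
    and m_le: "\<And>i j. i \<le> K \<Longrightarrow> j < i \<Longrightarrow> m i \<le> gp (x 0) (x j) (x i)"
    and m_ge: "\<And>i v. 0 < i \<Longrightarrow> i \<le> K \<Longrightarrow> v \<in> V \<Longrightarrow> \<exists>j<i. gp (x 0) (x j) v \<le> m i"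
begin

lemma m_antimono: "0 < i \<Longrightarrow> i \<le> K \<Longrightarrow> m K \<le> m i"
  using m_ge[of i "x K"] x[of K] m_le[of K] by (meson order.trans order_refl order_less_le_trans)

lemma gp_before: "j < i \<Longrightarrow> i \<le> K \<Longrightarrow> m K \<le> gp (x 0) (x j) (x i)"
  using m_antimono[of i] m_le[of i j] by fastforce

text \<open>\<open>gp_before\<close> bounds products at the later point. Here the base point
  \<open>x i\<close> precedes \<open>x j\<close>, and the comparison goes through a point
  \<open>x l\<close> with \<open>l < i\<close> whose product with \<open>x 0\<close> at
  \<open>x j\<close> is at most \<open>m i\<close>.\<close>

lemma gp_after:
  assumes "0 < i" "i < j" "j \<le> K"
  shows "m K - \<delta> \<le> gp (x 0) (x j) (x i)"
proof -
  have V: "x 0 \<in> V" "x i \<in> V" "x j \<in> V"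
    using assms x by simp_all
  obtain l where l: "l < i" "gp (x 0) (x l) (x j) \<le> m i"
    using m_ge[of i "x j"] V assms by auto
  then have Vl: "x l \<in> V"
    using x assms by simp
  have le: "gp (x 0) (x l) (x j) \<le> gp (x 0) (x l) (x i)"
    using l m_le[of i l] assms by linarith
  have ge: "gp (x 0) (x l) (x i) \<ge> m K" "gp (x 0) (x i) (x j) \<ge> m K"
    using gp_before l assms by simp_all
  \<comment> \<open>If the first product is the minimum, the leg of \<open>x i\<close> in the tripod
    with \<open>x j\<close> is at most \<open>\<delta>\<close> shorter than in the tripod with
    \<open>x l\<close>. Otherwise \<open>x j\<close> is at most \<open>\<delta>\<close> farther from
    \<open>x 0\<close> than \<open>x i\<close> is, and the bound at \<open>x j\<close> carries over
    to \<open>x i\<close>.\<close>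
  have "gp (x i) (x l) (x 0) \<ge> min (gp (x i) (x j) (x 0)) (gp (x j) (x l) (x 0)) - \<delta>"
    using gp_hyperbolic V Vl by blast
  then show ?thesis
    using le ge gp_add[of "x 0" "x l" "x i"] gp_add[of "x 0" "x l" "x j"]
      gp_add[of "x 0" "x i" "x j"] gp_add[of "x 0" "x j" "x i"] gp_commute[of "x i" "x j" "x 0"] V Vl
    by linarith
qed

lemma gp_first:
  assumes "0 < i" "0 < j" "i \<noteq> j" "i \<le> K" "j \<le> K"
  shows "m K - \<delta> \<le> gp (x 0) (x j) (x i)"
  using assms gp_after[of i j] gp_before[of j i] nonneg by (cases i j rule: linorder_cases) auto

text \<open>Since \<open>x 0\<close> is farthest from \<open>z\<close>, the branch of the tripod \<open>x 0, x i, x j\<close> at \<open>x 0\<close> is not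
  the shortest one.\<close>

lemma gp_at_first:
  assumes "0 < i" "0 < j" "i \<noteq> j" "i \<le> K" "j \<le> K"
  shows "m K - 3 * \<delta> \<le> gp (x i) (x j) (x 0)"
proof -
  have V: "x 0 \<in> V" "x i \<in> V" "x j \<in> V"
    using assms x by simp_all
  have far: "d z (x i) \<le> d z (x 0)" "d z (x j) \<le> d z (x 0)"
    using farthest V by simp_all
  have g: "m K - \<delta> \<le> gp (x 0) (x j) (x i)" "m K - \<delta> \<le> gp (x 0) (x i) (x j)"
    using gp_first assms by simp_all
  \<comment> \<open>As \<open>x 0\<close> is farthest from \<open>z\<close>, the terms at
    \<open>z\<close> cancel and \<open>d (x i) (x j)\<close> is at most \<open>2 * \<delta>\<close>
    above the larger of the distances from \<open>x 0\<close>. So the leg at \<open>x 0\<close> is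
    shorter than one of the other two legs by at most \<open>2 * \<delta>\<close>.\<close>
  have "real (d z (x 0) + d (x i) (x j)) \<le>
      max (real (d z (x i) + d (x 0) (x j))) (real (d (x i) (x 0) + d z (x j))) + 2 * \<delta>"
    using four_point z V by blast
  then show ?thesis
    using far g sym[of "x i" "x 0"] sym[of "x j" "x 0"] sym[of "x j" "x i"] V
    by (simp add: gp_def field_simps)
qed

text \<open>Base point \<open>x 0\<close> is the costliest case; for the others, going through
  \<open>x 0\<close> loses at most \<open>\<delta>\<close> on top of
  \<open>gp_first\<close>.\<close>

lemma gp_distinct:
  assumes "a \<noteq> b" "b \<noteq> c" "a \<noteq> c" "a \<le> K" "b \<le> K" "c \<le> K"
  shows "m K - 3 * \<delta> \<le> gp (x a) (x b) (x c)"
proof -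
  have V: "x 0 \<in> V" "x a \<in> V" "x b \<in> V" "x c \<in> V"
    using assms x by simp_all
  consider "c = 0" | "a = 0" | "b = 0" | "a > 0" "b > 0" "c > 0"
    by blast
  then show ?thesis
  proof cases
    case 4
    then show ?thesis
      using gp_hyperbolic[of "x a" "x 0" "x b" "x c"] gp_first[of c b] gp_first[of c a]
        gp_commute[of "x a" "x 0" "x c"] assms nonneg V by linarith
  qed (use gp_at_first[of a b] gp_first[of c b] gp_first[of c a] gp_commute[of "x a" "x 0" "x c"]
      assms nonneg V in auto)
qed

text \<open>Of the \<open>2 k + 1\<close> points, three are served by the same geodesic.\<close>

lemma greedy_lower_bound:
  fixes p :: "nat \<Rightarrow> nat \<Rightarrow> 'a"
  assumes k: "2 * k \<le> K" and R: "R \<ge> 0"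
    and geodesic: "\<And>c i j l. c < k \<Longrightarrow> i \<le> j \<Longrightarrow> j \<le> l \<Longrightarrow> l < len c \<Longrightarrow>
      d (p c i) (p c l) = d (p c i) (p c j) + d (p c j) (p c l)"
    and pV: "\<And>c i. c < k \<Longrightarrow> i < len c \<Longrightarrow> p c i \<in> V"
    and cover: "\<And>v. v \<in> V \<Longrightarrow> \<exists>c<k. \<exists>i<len c. real (d v (p c i)) \<le> R"
  shows "m K \<le> R + 5 * \<delta>"
proof (rule ccontr)
  assume "\<not> ?thesis"
  \<comment> \<open>The constant 5 consists of the \<open>3 * \<delta>\<close> lost in
    \<open>gp_distinct\<close> and the \<open>2 * \<delta>\<close> that
    \<open>three_points_on_geodesic\<close> requires.\<close>
  then have big: "gp (x a) (x b) (x c) > R + 2 * \<delta>"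
    if "a \<noteq> b" "b \<noteq> c" "a \<noteq> c" "a \<le> K" "b \<le> K" "c \<le> K" for a b c
    using gp_distinct[OF that] by linarith
  have "\<forall>a\<in>{..2*k}. \<exists>c i. c < k \<and> i < len c \<and> real (d (x a) (p c i)) \<le> R"
    using cover x k by (meson atMost_iff order_trans)
  then obtain f g :: "nat \<Rightarrow> nat" where fg: "\<And>a. a \<le> 2*k \<Longrightarrow> f a < k \<and> g a < len (f a) \<and> real (d (x a) (p (f a) (g a))) \<le> R"
    by (metis atMost_iff)
  \<comment> \<open>Pigeonhole: \<open>{..2*k}\<close> has \<open>2 * k + 1\<close> elements, but
    fibres of size at most 2 over \<open>k\<close> geodesics hold only \<open>2 * k\<close>.\<close>
  have "\<exists>c\<in>{..<k}. card {a\<in>{..2*k}. f a = c} > 2"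
  proof (rule ccontr)
    assume "\<not> ?thesis"
    then have "\<And>c. c \<in> {..<k} \<Longrightarrow> card {a\<in>{..2*k}. f a = c} \<le> 2"
      by (meson linorder_not_less)
    then have "(\<Sum>c<k. card {a\<in>{..2*k}. f a = c}) \<le> k * 2"
      using sum_bounded_above[of "{..<k}" "\<lambda>c. card {a\<in>{..2*k}. f a = c}" 2] by simp
    moreover have "(\<Sum>c<k. card {a\<in>{..2*k}. f a = c}) = card (\<Union>c<k. {a\<in>{..2*k}. f a = c})"
      by (subst card_UN_disjoint) auto
    moreover have "(\<Union>c<k. {a\<in>{..2*k}. f a = c}) = {..2*k}"
      using fg by auto
    ultimately show False
      by simp
  qed
  then obtain c where c: "c < k" "card {a\<in>{..2*k}. f a = c} > 2"
    by auto
  then have "3 \<le> card {a\<in>{..2*k}. f a = c}"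
    by simp
  then obtain S where "S \<subseteq> {a\<in>{..2*k}. f a = c}" "card S = 3"
    by (meson obtain_subset_with_card_n)
  then obtain a1 a2 a3 where a: "{a1,a2,a3} \<subseteq> {a\<in>{..2*k}. f a = c}" "a1 \<noteq> a2" "a2 \<noteq> a3" "a1 \<noteq> a3"
    by (auto simp: card_3_iff)
  \<comment> \<open>\<open>three_points_on_geodesic\<close> needs to know the middle point, so the
    three points are sorted by their positions \<open>g\<close> on the geodesic.\<close>
  have ordered: False if "{a,b,e} \<subseteq> {a\<in>{..2*k}. f a = c}" "a \<noteq> b" "b \<noteq> e" "a \<noteq> e" "g a \<le> g b" "g b \<le> g e" for a b e
  proof (rule three_points_on_geodesic)
    show "d (p c (g a)) (p c (g e)) = d (p c (g a)) (p c (g b)) + d (p c (g b)) (p c (g e))"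
      using that fg[of e] c by (intro geodesic) auto
    show "real (d (x a) (p c (g a))) \<le> R" "real (d (x b) (p c (g b))) \<le> R" "real (d (x e) (p c (g e))) \<le> R"
      "p c (g a) \<in> V" "p c (g b) \<in> V" "p c (g e) \<in> V"
      using that fg[of a] fg[of b] fg[of e] c pV by auto
    show "gp (x a) (x e) (x b) > R + 2 * \<delta>" "gp (x b) (x e) (x a) > R + 2 * \<delta>"
       "gp (x a) (x b) (x e) > R + 2 * \<delta>"
      using that k by (auto intro!: big)
    show "x a \<in> V" "x b \<in> V" "x e \<in> V"
      using that k x by auto
  qed
  consider "g a1 \<le> g a2" "g a2 \<le> g a3" | "g a1 \<le> g a3" "g a3 \<le> g a2" | "g a2 \<le> g a1" "g a1 \<le> g a3"
    | "g a2 \<le> g a3" "g a3 \<le> g a1" | "g a3 \<le> g a1" "g a1 \<le> g a2" | "g a3 \<le> g a2" "g a2 \<le> g a1"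
    using linear[of "g a1" "g a2"] linear[of "g a2" "g a3"] linear[of "g a1" "g a3"] by blast
  then show False
    using a ordered[of a1 a2 a3] ordered[of a1 a3 a2] ordered[of a2 a1 a3] ordered[of a2 a3 a1]
      ordered[of a3 a1 a2] ordered[of a3 a2 a1] by cases simp_all
qed

text \<open>By \<open>m_ge\<close> at \<open>K\<close>, some \<open>x l\<close> with
  \<open>l < K\<close> has product at most \<open>m K\<close> with \<open>x 0\<close> at
  \<open>v\<close>. Both points occur in pairs, and \<open>gp_pairing\<close> applies to these two
  pairs.\<close>

lemma pairing_cover:
  assumes AB: "\<And>i. i < k \<Longrightarrow> A i \<in> V \<and> B i \<in> V"
    and all: "\<And>j. j < K \<Longrightarrow> \<exists>i<k. x j = A i \<or> x j = B i"
    and swap: "\<And>i j. i < k \<Longrightarrow> j < k \<Longrightarrow>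
      d (A i) (B j) + d (A j) (B i) \<le> d (A i) (B i) + d (A j) (B j) \<and>
      d (A i) (A j) + d (B i) (B j) \<le> d (A i) (B i) + d (A j) (B j)"
    and v: "v \<in> V"
  shows "\<exists>i<k. gp (A i) (B i) v \<le> m K + 2 * \<delta>"
proof -
  obtain l where l: "l < K" "gp (x 0) (x l) v \<le> m K"
    using m_ge[of K v] K v by auto
  obtain i j where i: "i < k" "x 0 = A i \<or> x 0 = B i" and j: "j < k" "x l = A j \<or> x l = B j"
    using all l K by metis
  note V = AB[OF i(1)] AB[OF j(1)]
  have c: "gp (B i) (A i) v = gp (A i) (B i) v" "gp (B j) (A j) v = gp (A j) (B j) v"
    using gp_commute V v by simp_all
  have s: "d (B i) (A i) = d (A i) (B i)" "d (B j) (A j) = d (A j) (B j)" "d (B i) (A j) = d (A j) (B i)"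
     "d (B j) (A i) = d (A i) (B j)" "d (B j) (B i) = d (B i) (B j)" "d (A j) (A i) = d (A i) (A j)"
    using sym V by simp_all
  \<comment> \<open>\<open>x 0\<close> and \<open>x l\<close> may each be either end of their pairs.
    Ends of the same letter use the second exchange inequality, ends of different letters the
    first.\<close>
  have "gp (A i) (B i) v \<le> m K + 2 * \<delta> \<or> gp (A j) (B j) v \<le> m K + 2 * \<delta>"
    using i(2) j(2)
  proof (elim disjE, goal_cases)
    case 1
    then show ?case
      using gp_pairing[of "A i" "B i" "A j" "B j" v "m K"] V v l swap[OF i(1) j(1)] by auto
  next
    case 2
    then show ?case
      using gp_pairing[of "A i" "B i" "B j" "A j" v "m K"] V v l swap[OF i(1) j(1)] c s by auto
  next
    case 3
    then show ?case
      using gp_pairing[of "B i" "A i" "A j" "B j" v "m K"] V v l swap[OF i(1) j(1)] c s by auto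
  next
    case 4
    then show ?case
      using gp_pairing[of "B i" "A i" "B j" "A j" v "m K"] V v l swap[OF i(1) j(1)] c s by auto
  qed
  with i j show ?thesis
    by blast
qed

end


section \<open>Distances in connected graphs\<close>

lemma vwalk_iff_nth:
  "vwalk p G \<longleftrightarrow> p \<noteq> [] \<and> set p \<subseteq> verts G \<and>
    (\<forall>i. Suc i < length p \<longrightarrow> (p ! i, p ! Suc i) \<in> arcs_ends G)"
proof -
  have "vwalk_arcs p = zip p (tl p)"
    by (induction p rule: vwalk_arcs.induct) simp_all
  then have "set (vwalk_arcs p) = {(p ! i, p ! Suc i) |i. Suc i < length p}"
    by (auto simp: set_zip nth_tl)
  then show ?thesis
    by (auto simp: vwalk_def)
qed

locale connected_pair_graph = pair_graph G for G :: "'a pair_pre_digraph" +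
  assumes conn: "connected (with_proj G)"
begin

abbreviation d :: "'a \<Rightarrow> 'a \<Rightarrow> nat" where
  "d \<equiv> gdist G"

lemma nth_relpow:
  assumes "vwalk p (with_proj G)" "i \<le> j" "j < length p"
  shows "(p ! i, p ! j) \<in> parcs G ^^ (j - i)"
  using assms(2,3)
proof (induction j rule: dec_induct)
  case (step j)
  then have "(p ! j, p ! Suc j) \<in> parcs G"
    using assms(1) by (simp add: vwalk_iff_nth)
  with step show ?case
    by (auto simp: Suc_diff_le)
qed simp

lemma relpow_vwalk:
  assumes "(u, v) \<in> parcs G ^^ l" "u \<in> pverts G"
  shows "\<exists>p. vwalk p (with_proj G) \<and> hd p = u \<and> last p = v \<and> length p = Suc l"
  using assms
proof (induction l arbitrary: u)
  case 0
  then show ?case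
    by (intro exI[of _ "[u]"]) (auto simp: vwalk_iff_nth)
next
  case (Suc l)
  then obtain w where w: "(u, w) \<in> parcs G" "(w, v) \<in> parcs G ^^ l"
    by (meson relpow_Suc_D2)
  then obtain p where "vwalk p (with_proj G)" "hd p = w" "last p = v" "length p = Suc l"
    using Suc.IH in_arcsD2 by blast
  with w Suc.prems show ?case
    by (intro exI[of _ "u # p"]) (auto intro!: vwalk_consI)
qed

lemma vwalk_relpow:
  assumes "vwalk p (with_proj G)"
  shows "(hd p, last p) \<in> parcs G ^^ (length p - 1)"
  using nth_relpow[OF assms, of 0 "length p - 1"] assms
  by (auto simp: vwalk_iff_nth hd_conv_nth last_conv_nth)

text \<open>With powers of the arc relation, concatenating and reversing walks become
  \<open>relpow\<close> lemmas, which yield the metric axioms.\<close>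

lemma gdist_eq: "u \<in> pverts G \<Longrightarrow> d u v = (LEAST l. (u, v) \<in> parcs G ^^ l)"
proof -
  assume u: "u \<in> pverts G"
  have "(\<exists>p. vwalk p (with_proj G) \<and> hd p = u \<and> last p = v \<and> vwalk_length p = l) \<longleftrightarrow>
      (u, v) \<in> parcs G ^^ l" for l
  proof
    assume "(u, v) \<in> parcs G ^^ l"
    then obtain p where "vwalk p (with_proj G)" "hd p = u" "last p = v" "length p = Suc l"
      using relpow_vwalk[OF _ u] by blast
    then show "\<exists>p. vwalk p (with_proj G) \<and> hd p = u \<and> last p = v \<and> vwalk_length p = l"
      by (intro exI[of _ p]) simp
  next
    assume "\<exists>p. vwalk p (with_proj G) \<and> hd p = u \<and> last p = v \<and> vwalk_length p = l"
    then obtain p where "vwalk p (with_proj G)" "hd p = u" "last p = v" "length p - 1 = l"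
      unfolding vwalk_length_simp by blast
    then show "(u, v) \<in> parcs G ^^ l"
      using vwalk_relpow[of p] by blast
  qed
  then show ?thesis
    unfolding gdist_def by (simp only:)
qed

lemma gdist_le: "u \<in> pverts G \<Longrightarrow> (u, v) \<in> parcs G ^^ l \<Longrightarrow> d u v \<le> l"
  by (simp add: gdist_eq Least_le)

lemma ex_vwalk:
  assumes "u \<in> pverts G" "v \<in> pverts G"
  shows "\<exists>p. vwalk p (with_proj G) \<and> hd p = u \<and> last p = v"
  using symmetric_connected_imp_strongly_connected[OF pair_sym_arcs conn] assms
  by (auto simp: reachable_vwalk_conv[symmetric])

lemma gdist_relpow:
  assumes "u \<in> pverts G" "v \<in> pverts G"
  shows "(u, v) \<in> parcs G ^^ d u v"
  using ex_vwalk[OF assms] vwalk_relpow unfolding gdist_eq[OF assms(1)] by (metis LeastI)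

lemma gdist_refl: "u \<in> pverts G \<Longrightarrow> d u u = 0"
  using gdist_le[of u u 0] by simp

lemma gdist_eq_0: "u \<in> pverts G \<Longrightarrow> v \<in> pverts G \<Longrightarrow> d u v = 0 \<Longrightarrow> u = v"
  using gdist_relpow[of u v] by simp

lemma gdist_tri:
  "u \<in> pverts G \<Longrightarrow> v \<in> pverts G \<Longrightarrow> w \<in> pverts G \<Longrightarrow> d u w \<le> d u v + d v w"
  by (rule gdist_le, assumption, unfold relpow_add, rule relcompI; rule gdist_relpow)

lemma relpow_sym: "(u, v) \<in> parcs G ^^ l \<Longrightarrow> (v, u) \<in> parcs G ^^ l"
proof (induction l arbitrary: v)
  case (Suc l)
  then obtain w where "(u, w) \<in> parcs G ^^ l" "(w, v) \<in> parcs G"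
    by auto
  then show ?case
    using Suc.IH arcs_symmetric by (intro relpow_Suc_I2) auto
qed simp

lemma gdist_sym: "u \<in> pverts G \<Longrightarrow> v \<in> pverts G \<Longrightarrow> d u v = d v u"
  by (meson antisym gdist_le gdist_relpow relpow_sym)

lemma gdist_arc: "(u, v) \<in> parcs G \<Longrightarrow> d u v \<le> 1"
  by (rule gdist_le) (auto dest: in_arcsD1)

text \<open>The arc is the last one of a shortest walk. Both the correctness of the relaxation
  rounds and the descent along geodesics rest on it.\<close>

lemma gdist_SucE:
  assumes "u \<in> pverts G" "v \<in> pverts G" "d u v = Suc l"
  obtains w where "(w, v) \<in> parcs G" "d u w = l"
proof -
  obtain w where w: "(u, w) \<in> parcs G ^^ l" "(w, v) \<in> parcs G"
    using gdist_relpow[OF assms(1,2)] assms(3) by auto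
  have "w \<in> pverts G"
    using w in_arcsD1 by blast
  then have "d u w = l"
    using gdist_le[OF assms(1) w(1)] gdist_tri[of u w v] gdist_arc[OF w(2)] assms by linarith
  with w(2) that show thesis
    by blast
qed

text \<open>A walk can be shortened to a path, whose vertices are distinct. Hence the number of
  vertices can serve as infinity for distances and as the number of relaxation rounds.\<close>

lemma gdist_less_card:
  assumes "u \<in> pverts G" "v \<in> pverts G"
  shows "d u v < card (pverts G)"
proof -
  obtain p where "vwalk p (with_proj G)" "hd p = u" "last p = v"
    using ex_vwalk[OF assms] by blast
  then obtain q where q: "vpath q (with_proj G)" "hd q = u" "last q = v"
    using vwalk_imp_ex_vpath by metis
  then have "d u v \<le> length q - 1"
    using vwalk_relpow[of q] by (intro gdist_le assms) (auto simp: vpath_def)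
  moreover have "length q \<le> card (pverts G)"
    using q(1) card_mono[OF pair_finite_verts, of "set q"] distinct_card[of q]
    by (auto simp: vpath_def vwalk_def)
  moreover have "q \<noteq> []"
    using q(1) by (auto simp: vpath_def vwalk_def)
  ultimately show ?thesis
    by (cases q) auto
qed

lemma isometric_pathD:
  assumes "isometric_path G p"
  shows "vwalk p (with_proj G)" "p \<noteq> []" "set p \<subseteq> pverts G"
    "d (p ! 0) (p ! (length p - 1)) = length p - 1"
proof -
  show walk: "vwalk p (with_proj G)"
    using assms unfolding isometric_path_def vpath_def by blast
  then show "p \<noteq> []" "set p \<subseteq> pverts G"
    by (simp_all add: vwalk_def)
  then show "d (p ! 0) (p ! (length p - 1)) = length p - 1"
    using assms unfolding isometric_path_def vwalk_length_simp by (metis hd_conv_nth last_conv_nth)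
qed

text \<open>The lengths of the three segments cut off by \<open>i\<close> and \<open>j\<close> bound
  their distances from above, while these distances sum to at least the full length, so every bound
  is tight.\<close>

lemma isometric_path_dist:
  assumes "isometric_path G p" "i \<le> j" "j < length p"
  shows "d (p ! i) (p ! j) = j - i"
proof -
  note walk = isometric_pathD(1)[OF assms(1)] and len = isometric_pathD(4)[OF assms(1)]
  have V: "p ! l \<in> pverts G" if "l < length p" for l
    using isometric_pathD(3)[OF assms(1)] that by auto
  have le: "d (p ! a) (p ! b) \<le> b - a" if "a \<le> b" "b < length p" for a b
    using nth_relpow[OF walk that] V that by (intro gdist_le) auto
  have "p ! 0 \<in> pverts G" "p ! i \<in> pverts G" "p ! j \<in> pverts G" "p ! (length p - 1) \<in> pverts G"
    using assms(2,3) by (intro V; linarith)+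
  then have "length p - 1 \<le> d (p ! 0) (p ! i) + d (p ! i) (p ! j) + d (p ! j) (p ! (length p - 1))"
    using gdist_tri[of "p ! 0" "p ! i" "p ! (length p - 1)"]
      gdist_tri[of "p ! i" "p ! j" "p ! (length p - 1)"] len by linarith
  then show ?thesis
    using le[of 0 i] le[of i j] le[of j "length p - 1"] assms(2,3) by linarith
qed

text \<open>Distinctness follows from the length: cutting out the part between two occurrences of a
  vertex would leave a walk shorter than the distance.\<close>

lemma isometric_pathI:
  assumes walk: "vwalk p (with_proj G)" and len: "length p = Suc (d (hd p) (last p))"
  shows "isometric_path G p"
proof -
  have "p \<noteq> []"
    using len by auto
  then have len': "d (p ! 0) (p ! (length p - 1)) = length p - 1"
    using len by (metis diff_Suc_1 hd_conv_nth last_conv_nth)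
  have V: "p ! l \<in> pverts G" if "l < length p" for l
    using walk that by (auto simp: vwalk_def)
  have neq: "p ! i \<noteq> p ! j" if ij: "i < j" "j < length p" for i j
  proof
    assume "p ! i = p ! j"
    moreover have "(p ! 0, p ! i) \<in> parcs G ^^ i"
      using nth_relpow[OF walk, of 0 i] ij by simp
    moreover have "(p ! j, p ! (length p - 1)) \<in> parcs G ^^ (length p - 1 - j)"
      using ij by (intro nth_relpow[OF walk]) linarith+
    ultimately have "(p ! 0, p ! (length p - 1)) \<in> parcs G ^^ (i + (length p - 1 - j))"
      unfolding relpow_add by auto
    then have "d (p ! 0) (p ! (length p - 1)) \<le> i + (length p - 1 - j)"
      using V[of 0] \<open>p \<noteq> []\<close> by (intro gdist_le) auto
    then show False
      using len' ij by linarith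
  qed
  then have "distinct p"
    unfolding distinct_conv_nth by (metis nat_neq_iff)
  then show ?thesis
    using walk len by (simp add: isometric_path_def vpath_def)
qed

section \<open>Eccentricity, optimum and hyperbolicity in terms of distances\<close>

lemma pverts_nonempty: "pverts G \<noteq> {}"
  using conn by (simp add: connected_conv)

text \<open>\<open>k \<ge> 1\<close> and nonempty paths make the union nonempty, so
  \<open>Min\<close> and \<open>Max\<close> range over nonempty finite sets and unfold into
  quantifiers.\<close>

lemma eccentricity_le_iff:
  assumes "feasible G k Ps" "k \<ge> 1"
  shows "eccentricity G Ps \<le> r \<longleftrightarrow> (\<forall>v\<in>pverts G. \<exists>P\<in>set Ps. \<exists>w\<in>set P. d v w \<le> r)"
proof -
  let ?U = "\<Union>P\<in>set Ps. set P"
  have "Ps \<noteq> []" "\<forall>P\<in>set Ps. P \<noteq> []"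
    using assms isometric_pathD(2) by (auto simp: feasible_def)
  then have "?U \<noteq> {}"
    by (cases Ps) auto
  then have U: "d v ` ?U \<noteq> {}" "finite (d v ` ?U)" for v
    by simp_all
  have "{d u w |u w. u \<in> {v} \<and> w \<in> ?U} = d v ` ?U" for v
    by blast
  then have "set_gdist G {v} ?U \<le> r \<longleftrightarrow> (\<exists>w\<in>?U. d v w \<le> r)" for v
    using Min_le_iff[OF U(2,1), of v r] by (simp add: set_gdist_def)
  then show ?thesis
    using pverts_nonempty pair_finite_verts by (simp add: eccentricity_def)
qed

lemma opt_radius_attained:
  assumes "feasible G k Ps"
  shows "\<exists>Qs. feasible G k Qs \<and> eccentricity G Qs = opt_radius G k"
proof -
  have "opt_radius G k \<in> eccentricity G ` {Ps. feasible G k Ps}"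
    unfolding opt_radius_def by (rule Inf_nat_def1) (use assms in auto)
  then show ?thesis
    by (auto simp: image_iff)
qed

lemma hyperbolic_space:
  assumes "hyperbolic \<delta> G" "\<delta> \<ge> 0"
  shows "hyperbolic_space (pverts G) d \<delta>"
proof
  fix u v w x
  assume V: "u \<in> pverts G" "v \<in> pverts G" "w \<in> pverts G" "x \<in> pverts G"
  then have "gromov_product G u w x \<ge> min (gromov_product G u v x) (gromov_product G v w x) - \<delta>"
    using assms(1) by (simp add: hyperbolic_def)
  then show "real (d u w + d v x) \<le> max (real (d u v + d w x)) (real (d v w + d u x)) + 2 * \<delta>"
    using gdist_sym[of x w] gdist_sym[of x v] V
    by (auto simp: gromov_product_def min_def max_def field_simps split: if_splits)
qed (use assms(2) gdist_refl gdist_sym gdist_tri in auto)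

end

section \<open>The approximation guarantee for graphs\<close>

text \<open>Twice the Gromov product of \<open>x 0\<close> and \<open>x j\<close> at \<open>v\<close>.\<close>

definition tree_dist :: "'a pair_pre_digraph \<Rightarrow> (nat \<Rightarrow> 'a) \<Rightarrow> nat \<Rightarrow> 'a \<Rightarrow> nat" where
  "tree_dist G x j v = gdist G (x 0) v + gdist G v (x j) - gdist G (x 0) (x j)"

text \<open>\<open>m\<close> is necessarily the maximum over \<open>v\<close> of the minimum over
  \<open>j < i\<close>, attained at \<open>x i\<close>. The quantified form matches
  \<open>m_le\<close> and \<open>m_ge\<close> up to the factor 2.\<close>

definition greedy_sequence :: "'a pair_pre_digraph \<Rightarrow> 'a \<Rightarrow> nat \<Rightarrow> (nat \<Rightarrow> 'a) \<Rightarrow> bool" where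
  "greedy_sequence G z K x \<longleftrightarrow> (\<forall>i\<le>K. x i \<in> pverts G) \<and>
    (\<forall>v\<in>pverts G. gdist G z v \<le> gdist G z (x 0)) \<and>
    (\<forall>i\<in>{1..K}. \<exists>m. (\<forall>j<i. m \<le> tree_dist G x j (x i)) \<and>
      (\<forall>v\<in>pverts G. \<exists>j<i. tree_dist G x j v \<le> m))"

text \<open>The inequalities cover the two other ways of pairing the four points of pairs
  \<open>i\<close> and \<open>j\<close>. This is local optimality, weaker than a maximum total
  distance.\<close>

definition stable_pairing :: "'a pair_pre_digraph \<Rightarrow> nat \<Rightarrow> (nat \<Rightarrow> 'a) \<Rightarrow> (nat \<Rightarrow> 'a) \<Rightarrow> bool" where
  "stable_pairing G k A B \<longleftrightarrow> (\<forall>i<k. \<forall>j<k.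
    gdist G (A i) (B j) + gdist G (A j) (B i) \<le> gdist G (A i) (B i) + gdist G (A j) (B j) \<and>
    gdist G (A i) (A j) + gdist G (B i) (B j) \<le> gdist G (A i) (B i) + gdist G (A j) (B j))"

context connected_pair_graph
begin

text \<open>For \<open>r = m (2 * k) / 2\<close>, \<open>greedy_lower_bound\<close> gives that
  \<open>r\<close> is at most the optimum plus \<open>5 * \<delta>\<close>. The paths cover with
  radius \<open>r + 4 * \<delta> + 1/2\<close>, half of the \<open>4 * \<delta>\<close> coming from
  \<open>pairing_cover\<close> and half from \<open>dist_geodesic_le\<close>.\<close>

lemma approximation_rounded:
  assumes hyp: "hyperbolic \<delta> G" "\<delta> \<ge> 0" and k: "k \<ge> 1" and z: "z \<in> pverts G"
    and greedy: "greedy_sequence G z (2 * k) x"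
    and AB: "\<And>i. i < k \<Longrightarrow> A i \<in> pverts G \<and> B i \<in> pverts G"
    and all: "\<And>j. j < 2 * k \<Longrightarrow> \<exists>i<k. x j = A i \<or> x j = B i"
    and stable: "stable_pairing G k A B"
    and Ps: "feasible G k Ps" "\<And>i. i < k \<Longrightarrow> hd (Ps ! i) = A i \<and> last (Ps ! i) = B i"
  shows "real (eccentricity G Ps) \<le> real (opt_radius G k) + 9 * \<delta> + 1/2"
proof -
  interpret hyperbolic_space "pverts G" d \<delta>
    using hyperbolic_space[OF hyp] .
  \<comment> \<open>By the triangle inequality the truncated subtraction in \<open>tree_dist\<close>
    is exact.\<close>
  have gp: "gp (x 0) (x j) v = real (tree_dist G x j v) / 2" if "j \<le> 2 * k" "v \<in> pverts G" for j v
    using gdist_tri[of "x 0" v "x j"] that greedy by (simp add: gp_def tree_dist_def greedy_sequence_def)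
  obtain m where m: "\<And>i j. i \<in> {1..2*k} \<Longrightarrow> j < i \<Longrightarrow> m i \<le> tree_dist G x j (x i)"
    "\<And>i v. i \<in> {1..2*k} \<Longrightarrow> v \<in> pverts G \<Longrightarrow> \<exists>j<i. tree_dist G x j v \<le> m i"
    using greedy unfolding greedy_sequence_def by metis
  interpret greedy_points "pverts G" d \<delta> x z "2 * k" "\<lambda>i. real (m i) / 2"
  proof
    fix i j assume "i \<le> 2 * k" "j < i"
    then show "real (m i) / 2 \<le> gp (x 0) (x j) (x i)"
      using m(1)[of i j] gp[of j "x i"] greedy by (simp add: greedy_sequence_def)
  next
    fix i v assume i: "0 < i" "i \<le> 2 * k" "v \<in> pverts G"
    then obtain j where "j < i" "tree_dist G x j v \<le> m i"
      using m(2)[of i v] by auto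
    then show "\<exists>j<i. gp (x 0) (x j) v \<le> real (m i) / 2"
      using gp[of j v] i by (intro exI[of _ j]) simp
  qed (use greedy z k in \<open>auto simp: greedy_sequence_def\<close>)
  obtain Qs where Qs: "feasible G k Qs" "eccentricity G Qs = opt_radius G k"
    using opt_radius_attained[OF Ps(1)] by blast
  have iso: "isometric_path G (Qs ! c)" "isometric_path G (Ps ! c)" if "c < k" for c
    using Qs Ps that by (auto simp: feasible_def)
  have pathV: "P ! i \<in> pverts G" if "isometric_path G P" "i < length P" for P i
    using that isometric_pathD(3) by fastforce
  have "real (m (2 * k)) / 2 \<le> real (opt_radius G k) + 5 * \<delta>"
  proof (rule greedy_lower_bound)
    show "d (Qs ! c ! i) (Qs ! c ! l) = d (Qs ! c ! i) (Qs ! c ! j) + d (Qs ! c ! j) (Qs ! c ! l)"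
      if "c < k" "i \<le> j" "j \<le> l" "l < length (Qs ! c)" for c i j l
      using that isometric_path_dist[OF iso(1)[OF that(1)]] by simp
    show "\<exists>c<k. \<exists>i<length (Qs ! c). real (d v (Qs ! c ! i)) \<le> real (opt_radius G k)"
      if v: "v \<in> pverts G" for v
    proof -
      obtain Q w where "Q \<in> set Qs" "w \<in> set Q" "d v w \<le> opt_radius G k"
        using eccentricity_le_iff[OF Qs(1) k, THEN iffD1, OF eq_refl[OF Qs(2)]] v by blast
      then show ?thesis
        using Qs(1) by (auto simp: in_set_conv_nth feasible_def)
    qed
  qed (use iso pathV in auto)
  \<comment> \<open>Distances are integers, so the real radius may be rounded down, as
    \<open>eccentricity_le_iff\<close> expects a natural number.\<close>
  moreover have "\<exists>P\<in>set Ps. \<exists>w\<in>set P. d v w \<le> nat \<lfloor>real (m (2 * k)) / 2 + 4 * \<delta> + 1/2\<rfloor>" if v: "v \<in> pverts G" for v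
  proof -
    obtain c where c: "c < k" "gp (A c) (B c) v \<le> real (m (2 * k)) / 2 + 2 * \<delta>"
      using pairing_cover[of k A B v] AB all stable v by (auto simp: stable_pairing_def)
    let ?P = "Ps ! c"
    have "?P \<noteq> []"
      using isometric_pathD(2)[OF iso(2)[OF c(1)]] .
    then have P: "?P \<in> set Ps" "?P \<noteq> []" "?P ! 0 = A c" "?P ! (length ?P - 1) = B c"
      using Ps c(1) hd_conv_nth[of ?P] last_conv_nth[of ?P] by (auto simp: feasible_def)
    have dist: "d (?P ! i) (?P ! j) = j - i" if "i \<le> j" "j < length ?P" for i j
      using isometric_path_dist[OF iso(2)[OF c(1)]] that .
    have len: "d (A c) (B c) = length ?P - 1"
      using dist[of 0 "length ?P - 1"] P by simp
    have "\<exists>i\<le>d (A c) (B c). real (d v (?P ! i)) \<le> gp (A c) (B c) v + 2 * \<delta> + 1/2"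
    proof (rule dist_geodesic_le)
      fix i assume i: "i \<le> d (A c) (B c)"
      then have "i < length ?P"
        using len P(2) by (cases ?P) auto
      then show "?P ! i \<in> pverts G \<and> d (A c) (?P ! i) = i \<and> d (?P ! i) (B c) = d (A c) (B c) - i"
        using dist[of 0 i] dist[of i "length ?P - 1"] P len pathV[OF iso(2)[OF c(1)]] by simp
    qed (use AB c v in auto)
    then obtain i where i: "i \<le> d (A c) (B c)" "real (d v (?P ! i)) \<le> real (m (2 * k)) / 2 + 4 * \<delta> + 1/2"
      using c(2) by auto
    then have "i < length ?P"
      using len P(2) by (cases ?P) auto
    moreover have "d v (?P ! i) \<le> nat \<lfloor>real (m (2 * k)) / 2 + 4 * \<delta> + 1/2\<rfloor>"
      using i(2) by (simp add: le_nat_floor)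
    ultimately show ?thesis
      using P(1) nth_mem by blast
  qed
  then have "eccentricity G Ps \<le> nat \<lfloor>real (m (2 * k)) / 2 + 4 * \<delta> + 1/2\<rfloor>"
    using eccentricity_le_iff[OF Ps(1) k] by blast
  then have "real (eccentricity G Ps) \<le> real (m (2 * k)) / 2 + 4 * \<delta> + 1/2"
    using hyp(2) by (simp add: le_nat_iff le_floor_iff)
  ultimately show ?thesis
    by linarith
qed

text \<open>Gromov products are multiples of 1/2, so an inequality between them that fails by at
  most \<open>\<delta> < 1/2\<close> does not fail at all.\<close>

lemma hyperbolic_0:
  assumes "hyperbolic \<delta> G" "\<delta> < 1/2"
  shows "hyperbolic 0 G"
proof -
  have half: "(real a + real b - real c) / 2 \<ge> (real a' + real b' - real c') / 2"
    if "(real a + real b - real c) / 2 \<ge> (real a' + real b' - real c') / 2 - \<delta>" for a b c a' b' c' :: nat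
  proof -
    have "real (a' + b' + c) < real (a + b + c' + 1)"
    proof -
      have "y - x < 1" if "x / 2 \<ge> y / 2 - \<delta>" for x y :: real
        using that assms(2) by simp
      from this[OF that] show ?thesis
        by simp
    qed
    then have "a' + b' + c \<le> a + b + c'"
      unfolding of_nat_less_iff by simp
    then have "real (a' + b' + c) \<le> real (a + b + c')"
      unfolding of_nat_le_iff .
    then show ?thesis
      by simp
  qed
  have drop: "gromov_product G u w x \<ge> gromov_product G u' w' x" if
    "gromov_product G u w x \<ge> gromov_product G u' w' x - \<delta>" for u w x u' w'
    using half that unfolding gromov_product_def .
  show ?thesis
    unfolding hyperbolic_def
  proof (intro ballI)
    fix u v w x
    assume "u \<in> pverts G" "v \<in> pverts G" "w \<in> pverts G" "x \<in> pverts G"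
    then have "min (gromov_product G u v x) (gromov_product G v w x) - \<delta> \<le> gromov_product G u w x"
      using assms(1) by (simp add: hyperbolic_def)
    then show "gromov_product G u w x \<ge> min (gromov_product G u v x) (gromov_product G v w x) - 0"
      using drop[of u v x u w] drop[of v w x u w]
      by (cases "gromov_product G u v x \<le> gromov_product G v w x") (simp_all add: min_def)
  qed
qed

text \<open>The \<open>1/2\<close> is absorbed in two ways. For \<open>\<delta> < 1/2\<close> the
  graph is 0-hyperbolic and an integer excess of at most 1/2 vanishes; otherwise \<open>1/2\<close>
  is at most \<open>\<delta>\<close>.\<close>

lemma approximation:
  assumes "hyperbolic \<delta> G" "\<delta> \<ge> 0" and k: "k \<ge> 1" and "z \<in> pverts G"
    and "greedy_sequence G z (2 * k) x"
    and "\<And>i. i < k \<Longrightarrow> A i \<in> pverts G \<and> B i \<in> pverts G"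
    and "\<And>j. j < 2 * k \<Longrightarrow> \<exists>i<k. x j = A i \<or> x j = B i"
    and "stable_pairing G k A B"
    and "feasible G k Ps" "\<And>i. i < k \<Longrightarrow> hd (Ps ! i) = A i \<and> last (Ps ! i) = B i"
  shows "real (eccentricity G Ps) \<le> real (opt_radius G k) + 10 * \<delta>"
proof (cases "\<delta> < 1/2")
  case True
  then have "real (eccentricity G Ps) \<le> real (opt_radius G k) + 9 * 0 + 1/2"
    using assms by (intro approximation_rounded hyperbolic_0) auto
  then have "real (eccentricity G Ps) < real (opt_radius G k + 1)"
    by simp
  then have "eccentricity G Ps \<le> opt_radius G k"
    unfolding of_nat_less_iff by simp
  then have "real (eccentricity G Ps) \<le> real (opt_radius G k)"
    by simp
  then show ?thesis
    using assms(2) by linarith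
next
  case False
  have "real (eccentricity G Ps) \<le> real (opt_radius G k) + 9 * \<delta> + 1/2"
    using assms by (intro approximation_rounded) auto
  then show ?thesis
    using False by linarith
qed

end


section \<open>Running times of programs\<close>

text \<open>Total correctness with a time bound. The start state is fixed instead of described by a
  precondition, so that \<open>Q\<close> can refer to it.\<close>

definition runs :: "com \<Rightarrow> state \<Rightarrow> nat \<Rightarrow> (state \<Rightarrow> bool) \<Rightarrow> bool" where
  "runs c s T Q \<longleftrightarrow> (\<exists>t s'. exec c s t s' \<and> t \<le> T \<and> Q s')"

lemma runs_mono: "runs c s T Q \<Longrightarrow> T \<le> T' \<Longrightarrow> (\<And>s'. Q s' \<Longrightarrow> Q' s') \<Longrightarrow> runs c s T' Q'"
  unfolding runs_def by (meson order_trans)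

lemma runs_Skip: "Q s \<Longrightarrow> runs Skip s 1 Q"
  unfolding runs_def by (blast intro: exec.Skip)

lemma runs_Assign:
  "Q (s(x := (s x)(map (\<lambda>e. aval e s) es := aval a s))) \<Longrightarrow> runs (Assign x es a) s 1 Q"
  unfolding runs_def by (blast intro: exec.Assign)

lemma runs_Seq:
  "runs c1 s T1 P \<Longrightarrow> (\<And>s'. P s' \<Longrightarrow> runs c2 s' T2 Q) \<Longrightarrow> runs (Seq c1 c2) s (T1 + T2) Q"
  unfolding runs_def by (meson add_mono exec.Seq)

lemma runs_If:
  assumes "bval b s \<Longrightarrow> runs c1 s T Q" "\<not> bval b s \<Longrightarrow> runs c2 s T Q"
  shows "runs (If b c1 c2) s (1 + T) Q"
  using assms unfolding runs_def by (meson IfFalse IfTrue add_left_mono)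

text \<open>The measure bounds the number of iterations by \<open>m\<close>; each costs a test and
  the body, and one failing test is added.\<close>

lemma runs_While:
  fixes f :: "state \<Rightarrow> nat"
  assumes body: "\<And>s. I s \<Longrightarrow> bval b s \<Longrightarrow> runs c s T (\<lambda>s'. I s' \<and> f s' < f s)"
    and "I s" "f s \<le> m"
  shows "runs (While b c) s (1 + m * (1 + T)) (\<lambda>s'. I s' \<and> \<not> bval b s')"
  using assms(2,3)
proof (induction m arbitrary: s)
  case 0
  then show ?case
    using body[of s] exec.WhileFalse[of b s c] unfolding runs_def by auto
next
  case (Suc m)
  show ?case
  proof (cases "bval b s")
    case True
    with body Suc.prems obtain t s' where t: "exec c s t s'" "t \<le> T" "I s'" "f s' < f s"
      unfolding runs_def by blast
    with Suc.prems Suc.IH[of s'] obtain u s'' where "exec (While b c) s' u s''" "u \<le> 1 + m * (1 + T)"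
      "I s''" "\<not> bval b s''"
      unfolding runs_def by auto
    then show ?thesis
      using exec.WhileTrue[OF True t(1)] t(2) unfolding runs_def
      by (intro exI[of _ "1 + t + u"] exI[of _ s'']) auto
  next
    case False
    then show ?thesis
      using exec.WhileFalse[of b s c] Suc.prems unfolding runs_def by fastforce
  qed
qed

fun wvars :: "com \<Rightarrow> vname set" where
  "wvars Skip = {}"
| "wvars (Assign x es a) = {x}"
| "wvars (Seq c1 c2) = wvars c1 \<union> wvars c2"
| "wvars (If b c1 c2) = wvars c1 \<union> wvars c2"
| "wvars (While b c) = wvars c"

lemma exec_frame: "exec c s t s' \<Longrightarrow> x \<notin> wvars c \<Longrightarrow> s' x = s x"
  by (induction rule: exec.induct) auto

lemma runs_frame:
  assumes "runs c s T Q"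
  shows "runs c s T (\<lambda>s'. Q s' \<and> (\<forall>x. x \<notin> wvars c \<longrightarrow> s' x = s x))"
  using assms exec_frame unfolding runs_def by blast

definition For :: "vname \<Rightarrow> aexp \<Rightarrow> com \<Rightarrow> com" where
  "For x e c = Seq (Assign x [] (N 0))
    (While (Less (V x []) e) (Seq c (Assign x [] (Plus (V x []) (N 1)))))"

lemma wvars_For [simp]: "wvars (For x e c) = insert x (wvars c)"
  by (auto simp: For_def)

definition upd :: "state \<Rightarrow> vname \<Rightarrow> nat \<Rightarrow> state" where
  "upd s x v = s(x := (s x)([] := v))"

lemma upd_simps [simp]: "upd s x v x [] = v" "y \<noteq> x \<Longrightarrow> upd s x v y = s y"
  by (simp_all add: upd_def)

text \<open>The bound \<open>e\<close> is evaluated anew at every test, hence the assumption that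
  its value survives whatever the loop writes. \<open>upd\<close> expresses that \<open>I\<close>
  speaks of states whose counter is already set. An iteration costs \<open>T\<close> plus an
  increment and a test; the leading 2 is the initialisation and the final test.\<close>

lemma runs_For:
  assumes bound: "\<And>s'. (\<And>y. y \<notin> wvars (For x e c) \<Longrightarrow> s' y = s y) \<Longrightarrow> aval e s' = m"
    and x: "x \<notin> wvars c"
    and init: "I 0 (upd s x 0)"
    and body: "\<And>i s'. i < m \<Longrightarrow> I i s' \<Longrightarrow> s' x [] = i \<Longrightarrow>
      (\<And>y. y \<notin> wvars (For x e c) \<Longrightarrow> s' y = s y) \<Longrightarrow> runs c s' T (\<lambda>s''. I (Suc i) (upd s'' x (Suc i)))"
  shows "runs (For x e c) s (2 + m * (2 + T)) (I m)"
proof -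
  let ?J = "\<lambda>s'. s' x [] \<le> m \<and> I (s' x []) s' \<and> (\<forall>y. y \<notin> wvars (For x e c) \<longrightarrow> s' y = s y)"
  let ?c = "Seq c (Assign x [] (Plus (V x []) (N 1)))"
  have loop: "runs (While (Less (V x []) e) ?c) (upd s x 0) (1 + m * (1 + (T + 1)))
      (\<lambda>s'. ?J s' \<and> \<not> bval (Less (V x []) e) s')"
  proof (rule runs_While)
    fix s' assume J: "?J s'" and "bval (Less (V x []) e) s'"
    then have less: "s' x [] < m"
      using bound[of s'] by simp
    let ?i = "s' x []"
    have "runs c s' T (\<lambda>s''. I (Suc ?i) (upd s'' x (Suc ?i)) \<and> (\<forall>y. y \<notin> wvars c \<longrightarrow> s'' y = s' y))"
      by (rule runs_frame, rule body) (use less J in auto)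
    then show "runs ?c s' (T + 1) (\<lambda>s''. ?J s'' \<and> m - s'' x [] < m - s' x [])"
    proof (rule runs_Seq)
      fix s'' assume s'': "I (Suc ?i) (upd s'' x (Suc ?i)) \<and> (\<forall>y. y \<notin> wvars c \<longrightarrow> s'' y = s' y)"
      then have "s''(x := (s'' x)(map (\<lambda>e. aval e s'') [] := aval (Plus (V x []) (N 1)) s'')) =
          upd s'' x (Suc ?i)"
        using x by (simp add: upd_def)
      with s'' less J show "runs (Assign x [] (Plus (V x []) (N 1))) s'' 1
          (\<lambda>s''. ?J s'' \<and> m - s'' x [] < m - s' x [])"
        by (intro runs_Assign) auto
    qed
  qed (use init in auto)
  have "runs (For x e c) s (1 + (1 + m * (1 + (T + 1)))) (\<lambda>s'. ?J s' \<and> \<not> bval (Less (V x []) e) s')"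
    unfolding For_def
  proof (rule runs_Seq[OF runs_Assign])
    show "s(x := (s x)(map (\<lambda>e. aval e s) [] := aval (N 0) s)) = upd s x 0"
      by (simp add: upd_def)
  qed (use loop in simp)
  then show ?thesis
    by (rule runs_mono) (use bound in \<open>auto dest!: le_neq_implies_less\<close>)
qed

text \<open>\<open>sem\<close> and \<open>cost\<close> are meaningful for loop-free programs only.\<close>

fun sem :: "com \<Rightarrow> state \<Rightarrow> state" where
  "sem Skip s = s"
| "sem (Assign x es a) s = s(x := (s x)(map (\<lambda>e. aval e s) es := aval a s))"
| "sem (Seq c1 c2) s = sem c2 (sem c1 s)"
| "sem (If b c1 c2) s = (if bval b s then sem c1 s else sem c2 s)"
| "sem (While b c) s = s"

fun cost :: "com \<Rightarrow> nat" where
  "cost Skip = 1"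
| "cost (Assign x es a) = 1"
| "cost (Seq c1 c2) = cost c1 + cost c2"
| "cost (If b c1 c2) = 1 + max (cost c1) (cost c2)"
| "cost (While b c) = 0"

fun loop_free :: "com \<Rightarrow> bool" where
  "loop_free (Seq c1 c2) \<longleftrightarrow> loop_free c1 \<and> loop_free c2"
| "loop_free (If b c1 c2) \<longleftrightarrow> loop_free c1 \<and> loop_free c2"
| "loop_free (While b c) \<longleftrightarrow> False"
| "loop_free _ \<longleftrightarrow> True"

lemma runs_loop_free: "loop_free c \<Longrightarrow> Q (sem c s) \<Longrightarrow> runs c s (cost c) Q"
proof (induction c arbitrary: s Q)
  case (Seq c1 c2)
  then show ?case
    using runs_Seq[of c1 s "cost c1" "\<lambda>s'. s' = sem c1 s" c2 "cost c2" Q] by simp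
next
  case (If b c1 c2)
  have "runs (if bval b s then c1 else c2) s (max (cost c1) (cost c2)) Q"
    using If by (auto intro: runs_mono[of c1 s "cost c1" Q] runs_mono[of c2 s "cost c2" Q])
  then show ?case
    using runs_If[of b s c1 "max (cost c1) (cost c2)" Q c2] by (cases "bval b s") simp_all
qed (auto intro: runs_Skip[unfolded One_nat_def] runs_Assign[unfolded One_nat_def])

lemma runs_straight: "loop_free c \<Longrightarrow> cost c \<le> T \<Longrightarrow> Q (sem c s) \<Longrightarrow> runs c s T Q"
  using runs_loop_free runs_mono by blast

abbreviation Var :: "vname \<Rightarrow> aexp" where
  "Var x \<equiv> V x []"

section \<open>Instances and their representation in memory\<close>

locale gc_input = connected_pair_graph G for G :: "nat pair_pre_digraph" +
  fixes k :: nat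
  assumes verts: "pverts G = {..<card (pverts G)}" and k: "k \<ge> 1"
begin

abbreviation n :: nat where
  "n \<equiv> card (pverts G)"

lemma in_verts [simp]: "u \<in> pverts G \<longleftrightarrow> u < n"
  using verts by blast

lemma n_pos: "n > 0"
  using pverts_nonempty pair_finite_verts by (simp add: card_gt_0_iff)

definition input_ok :: "state \<Rightarrow> bool" where
  "input_ok s \<longleftrightarrow> s ''n'' [] = n \<and> s ''k'' [] = k \<and>
    (\<forall>u v. s ''adj'' [u, v] = (if (u, v) \<in> parcs G then 1 else 0))"

lemma input_ok_cong:
  assumes "input_ok s" "s' ''n'' = s ''n''" "s' ''k'' = s ''k''" "s' ''adj'' = s ''adj''"
  shows "input_ok s'"
  using assms by (simp add: input_ok_def)

lemma input_okD [simp]: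
  assumes "input_ok s"
  shows "s ''n'' [] = n" "s ''k'' [] = k" "s ''adj'' [u, v] = (if (u, v) \<in> parcs G then 1 else 0)"
  using assms by (simp_all add: input_ok_def)

end


section \<open>All distances\<close>

definition relax :: com where
  "relax = If (And (Less (N 0) (V ''adj'' [Var ''v'', Var ''w'']))
      (Less (Plus (V ''D'' [Var ''u'', Var ''v'']) (N 1)) (V ''D'' [Var ''u'', Var ''w''])))
    (Assign ''D'' [Var ''u'', Var ''w''] (Plus (V ''D'' [Var ''u'', Var ''v'']) (N 1))) Skip"

text \<open>Bellman-Ford from all sources at once: \<open>n\<close> acts as infinity, and each of
  the \<open>n\<close> rounds relaxes every arc for every source.\<close>

definition distances :: com where
  "distances = Seq
    (For ''u'' (Var ''n'') (Seq (For ''v'' (Var ''n'') (Assign ''D'' [Var ''u'', Var ''v''] (Var ''n'')))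
      (Assign ''D'' [Var ''u'', Var ''u''] (N 0))))
    (For ''r'' (Var ''n'') (For ''u'' (Var ''n'') (For ''v'' (Var ''n'') (For ''w'' (Var ''n'') relax))))"

lemma wvars_relax [simp]: "wvars relax = {''D''}"
  by (simp add: relax_def)

lemma wvars_distances [simp]: "wvars distances = {''u'', ''v'', ''D'', ''r'', ''w''}"
  by (auto simp: distances_def)

definition For_time :: "nat \<Rightarrow> nat \<Rightarrow> nat" where
  "For_time m T = 2 + m * (2 + T)"

lemmas runs_For' = runs_For[folded For_time_def]

context gc_input
begin

text \<open>Invariant inside one round: \<open>D0\<close> is the matrix at its start and
  \<open>S\<close> the set of triples already treated. Comparing with \<open>D0\<close> instead of
  the current matrix makes it robust against updates in place, which only lower entries.\<close>

definition relaxed :: "(nat \<times> nat \<times> nat) set \<Rightarrow> (nat \<Rightarrow> nat \<Rightarrow> nat) \<Rightarrow> (nat list \<Rightarrow> nat) \<Rightarrow> bool" where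
  "relaxed S D0 D \<longleftrightarrow> (\<forall>u<n. \<forall>v<n. d u v \<le> D [u, v] \<and> D [u, v] \<le> D0 u v) \<and>
    (\<forall>u v w. (u, v, w) \<in> S \<longrightarrow> (v, w) \<in> parcs G \<longrightarrow> D [u, w] \<le> D0 u v + 1)"

lemma relaxed_step:
  assumes "relaxed S D0 D" "u < n" "v < n" "w < n"
  shows "relaxed (insert (u, v, w) S) D0
    (if (v, w) \<in> parcs G \<and> D [u, v] + 1 < D [u, w] then D([u, w] := D [u, v] + 1) else D)"
proof -
  have "d u w \<le> D [u, v] + 1" if "(v, w) \<in> parcs G"
    using gdist_tri[of u v w] gdist_arc[OF that] assms by (fastforce simp: relaxed_def)
  then show ?thesis
    using assms unfolding relaxed_def by (fastforce simp: not_less)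
qed

lemma runs_relax:
  assumes "input_ok s" "s ''u'' [] = u" "s ''v'' [] = v" "s ''w'' [] = w" "u < n" "v < n" "w < n"
    "relaxed S D0 (s ''D'')"
  shows "runs relax s 2 (\<lambda>s'. relaxed (insert (u, v, w) S) D0 (s' ''D''))"
  using relaxed_step[OF assms(8,5,6,7)] assms(1-4)
  by (intro runs_straight) (auto simp: relax_def split: if_splits)

lemma runs_relax_w:
  assumes "input_ok s" "s ''u'' [] = u" "s ''v'' [] = v" "u < n" "v < n" "relaxed S D0 (s ''D'')"
  shows "runs (For ''w'' (Var ''n'') relax) s (For_time n 2)
    (\<lambda>s'. relaxed (S \<union> {u} \<times> {v} \<times> {..<n}) D0 (s' ''D''))"
proof (rule runs_For'[where I = "\<lambda>i s. relaxed (S \<union> {u} \<times> {v} \<times> {..<i}) D0 (s ''D'')"])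
  fix i s'
  assume s': "i < n" "relaxed (S \<union> {u} \<times> {v} \<times> {..<i}) D0 (s' ''D'')" "s' ''w'' [] = i"
    "\<And>y. y \<notin> wvars (For ''w'' (Var ''n'') relax) \<Longrightarrow> s' y = s y"
  have "insert (u, v, i) (S \<union> {u} \<times> {v} \<times> {..<i}) = S \<union> {u} \<times> {v} \<times> {..<Suc i}"
    by auto
  then show "runs relax s' 2 (\<lambda>s''. relaxed (S \<union> {u} \<times> {v} \<times> {..<Suc i}) D0 (upd s'' ''w'' (Suc i) ''D''))"
    using runs_relax[of s' u v i "S \<union> {u} \<times> {v} \<times> {..<i}" D0] assms s' input_ok_cong[of s s'] by simp
qed (use assms in auto)

lemma runs_relax_v:
  assumes "input_ok s" "s ''u'' [] = u" "u < n" "relaxed S D0 (s ''D'')"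
  shows "runs (For ''v'' (Var ''n'') (For ''w'' (Var ''n'') relax)) s (For_time n (For_time n 2))
    (\<lambda>s'. relaxed (S \<union> {u} \<times> {..<n} \<times> {..<n}) D0 (s' ''D''))"
proof (rule runs_For'[where I = "\<lambda>i s. relaxed (S \<union> {u} \<times> {..<i} \<times> {..<n}) D0 (s ''D'')"])
  fix i s'
  assume s': "i < n" "relaxed (S \<union> {u} \<times> {..<i} \<times> {..<n}) D0 (s' ''D'')" "s' ''v'' [] = i"
    "\<And>y. y \<notin> wvars (For ''v'' (Var ''n'') (For ''w'' (Var ''n'') relax)) \<Longrightarrow> s' y = s y"
  have "S \<union> {u} \<times> {..<i} \<times> {..<n} \<union> {u} \<times> {i} \<times> {..<n} = S \<union> {u} \<times> {..<Suc i} \<times> {..<n}"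
    by auto
  then show "runs (For ''w'' (Var ''n'') relax) s' (For_time n 2)
      (\<lambda>s''. relaxed (S \<union> {u} \<times> {..<Suc i} \<times> {..<n}) D0 (upd s'' ''v'' (Suc i) ''D''))"
    using runs_relax_w[of s' u i "S \<union> {u} \<times> {..<i} \<times> {..<n}" D0] assms s' input_ok_cong[of s s']
    by simp
qed (use assms in auto)

lemma runs_relax_u:
  assumes "input_ok s" "relaxed {} D0 (s ''D'')"
  shows "runs (For ''u'' (Var ''n'') (For ''v'' (Var ''n'') (For ''w'' (Var ''n'') relax))) s
    (For_time n (For_time n (For_time n 2))) (\<lambda>s'. relaxed ({..<n} \<times> {..<n} \<times> {..<n}) D0 (s' ''D''))"
proof (rule runs_For'[where I = "\<lambda>i s. relaxed ({..<i} \<times> {..<n} \<times> {..<n}) D0 (s ''D'')"])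
  fix i s'
  assume s': "i < n" "relaxed ({..<i} \<times> {..<n} \<times> {..<n}) D0 (s' ''D'')" "s' ''u'' [] = i"
    "\<And>y. y \<notin> wvars (For ''u'' (Var ''n'') (For ''v'' (Var ''n'') (For ''w'' (Var ''n'') relax))) \<Longrightarrow> s' y = s y"
  have "{..<i} \<times> {..<n} \<times> {..<n} \<union> {i} \<times> {..<n} \<times> {..<n} = {..<Suc i} \<times> {..<n} \<times> {..<n}"
    by auto
  then show "runs (For ''v'' (Var ''n'') (For ''w'' (Var ''n'') relax)) s' (For_time n (For_time n 2))
      (\<lambda>s''. relaxed ({..<Suc i} \<times> {..<n} \<times> {..<n}) D0 (upd s'' ''u'' (Suc i) ''D''))"
    using runs_relax_v[of s' i "{..<i} \<times> {..<n} \<times> {..<n}" D0] assms s' input_ok_cong[of s s'] by simp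
qed (use assms in auto)

definition dist_upto :: "nat \<Rightarrow> (nat list \<Rightarrow> nat) \<Rightarrow> bool" where
  "dist_upto l D \<longleftrightarrow> (\<forall>u<n. \<forall>v<n. d u v \<le> D [u, v] \<and> (d u v \<le> l \<longrightarrow> D [u, v] = d u v))"

definition dist_ok :: "(nat list \<Rightarrow> nat) \<Rightarrow> bool" where
  "dist_ok D \<longleftrightarrow> (\<forall>u<n. \<forall>v<n. D [u, v] = d u v)"

lemma dist_okD [simp]: "dist_ok D \<Longrightarrow> u < n \<Longrightarrow> v < n \<Longrightarrow> D [u, v] = d u v"
  by (simp add: dist_ok_def)

text \<open>Induction step of Bellman-Ford: the entry of the last but one vertex \<open>w\<close> of
  a shortest walk was exact before the round, and the round has relaxed the arc from
  \<open>w\<close> to \<open>v\<close>.\<close>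

lemma dist_upto_Suc:
  assumes D: "dist_upto l D" and D': "relaxed ({..<n} \<times> {..<n} \<times> {..<n}) (\<lambda>u v. D [u, v]) D'"
  shows "dist_upto (Suc l) D'"
  unfolding dist_upto_def
proof (intro allI impI conjI)
  fix u v
  assume uv: "u < n" "v < n"
  show le: "d u v \<le> D' [u, v]"
    using D' uv by (simp add: relaxed_def)
  assume "d u v \<le> Suc l"
  then consider "d u v \<le> l" | "d u v = Suc l"
    by linarith
  then show "D' [u, v] = d u v"
  proof cases
    case 1
    then have "D [u, v] = d u v"
      using D uv by (simp add: dist_upto_def)
    moreover have "D' [u, v] \<le> D [u, v]"
      using D' uv by (simp add: relaxed_def)
    ultimately show ?thesis
      using le by simp
  next
    case 2
    then obtain w where w: "(w, v) \<in> parcs G" "d u w = l"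
      using gdist_SucE[of u v l] uv by auto
    then have "w < n"
      using in_arcsD1[OF w(1)] by simp
    then have "D [u, w] = l"
      using D uv w(2) by (simp add: dist_upto_def)
    moreover have "D' [u, v] \<le> D [u, w] + 1"
      using D' uv w(1) \<open>w < n\<close> unfolding relaxed_def by blast
    ultimately show ?thesis
      using 2 le by simp
  qed
qed

lemma runs_distances:
  assumes "input_ok s"
  shows "runs distances s (For_time n (For_time n 1 + 1) + For_time n (For_time n (For_time n (For_time n 2))))
    (\<lambda>s'. dist_ok (s' ''D''))"
  unfolding distances_def
proof (rule runs_Seq[OF runs_frame])
  let ?row = "\<lambda>u D. \<forall>v<n. D [u, v] = (if u = v then 0 else n)"
  let ?c = "Seq (For ''v'' (Var ''n'') (Assign ''D'' [Var ''u'', Var ''v''] (Var ''n'')))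
      (Assign ''D'' [Var ''u'', Var ''u''] (N 0))"
  show "runs (For ''u'' (Var ''n'') ?c) s (For_time n (For_time n 1 + 1)) (\<lambda>s'. \<forall>u<n. ?row u (s' ''D''))"
  proof (rule runs_For'[where I = "\<lambda>i s. \<forall>u<i. ?row u (s ''D'')"])
    fix i s'
    assume s': "i < n" "\<forall>u<i. ?row u (s' ''D'')" "s' ''u'' [] = i"
      "\<And>y. y \<notin> wvars (For ''u'' (Var ''n'') ?c) \<Longrightarrow> s' y = s y"
    then have "input_ok s'"
      using assms input_ok_cong[of s s'] by simp
    let ?J = "\<lambda>j s''. (\<forall>u<i. ?row u (s'' ''D'')) \<and> (\<forall>v<j. s'' ''D'' [i, v] = n)"
    show "runs ?c s' (For_time n 1 + 1) (\<lambda>s''. \<forall>u<Suc i. ?row u (upd s'' ''u'' (Suc i) ''D''))"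
    proof (rule runs_Seq[OF runs_frame])
      show "runs (For ''v'' (Var ''n'') (Assign ''D'' [Var ''u'', Var ''v''] (Var ''n''))) s' (For_time n 1) (?J n)"
      proof (rule runs_For'[where I = ?J])
        fix j t
        assume "j < n" "?J j t" "t ''v'' [] = j"
          "\<And>y. y \<notin> wvars (For ''v'' (Var ''n'') (Assign ''D'' [Var ''u'', Var ''v''] (Var ''n''))) \<Longrightarrow> t y = s' y"
        then show "runs (Assign ''D'' [Var ''u'', Var ''v''] (Var ''n'')) t 1 (\<lambda>t'. ?J (Suc j) (upd t' ''v'' (Suc j)))"
          using s' assms by (intro runs_Assign) (simp add: less_Suc_eq)
      qed (use s' assms in simp_all)
    next
      fix t
      assume "?J n t \<and> (\<forall>y. y \<notin> wvars (For ''v'' (Var ''n'') (Assign ''D'' [Var ''u'', Var ''v''] (Var ''n''))) \<longrightarrow> t y = s' y)"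
      then show "runs (Assign ''D'' [Var ''u'', Var ''u''] (N 0)) t 1
          (\<lambda>t'. \<forall>u<Suc i. ?row u (upd t' ''u'' (Suc i) ''D''))"
        using s' by (intro runs_Assign) (simp add: less_Suc_eq)
    qed
  qed (use assms in simp_all)
next
  fix s1
  assume s1: "(\<forall>u<n. \<forall>v<n. s1 ''D'' [u, v] = (if u = v then 0 else n)) \<and>
    (\<forall>x. x \<notin> wvars (For ''u'' (Var ''n'') (Seq (For ''v'' (Var ''n'') (Assign ''D'' [Var ''u'', Var ''v''] (Var ''n'')))
      (Assign ''D'' [Var ''u'', Var ''u''] (N 0)))) \<longrightarrow> s1 x = s x)"
  then have in1: "input_ok s1"
    using assms input_ok_cong[of s s1] by simp
  have less: "d u v < n" if "u < n" "v < n" for u v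
    using gdist_less_card that by simp
  \<comment> \<open>Distance 0 occurs on the diagonal only, and \<open>n\<close> exceeds all
    distances.\<close>
  have "dist_upto 0 (s1 ''D'')"
    using s1 less gdist_eq_0 gdist_refl by (auto simp: dist_upto_def less_imp_le)
  let ?c = "For ''u'' (Var ''n'') (For ''v'' (Var ''n'') (For ''w'' (Var ''n'') relax))"
  have "runs (For ''r'' (Var ''n'') ?c) s1 (For_time n (For_time n (For_time n (For_time n 2))))
    (\<lambda>s'. dist_upto n (s' ''D''))"
  proof (rule runs_For'[where I = "\<lambda>i s. dist_upto i (s ''D'')"])
    fix i s'
    assume s': "i < n" "dist_upto i (s' ''D'')" "\<And>y. y \<notin> wvars (For ''r'' (Var ''n'') ?c) \<Longrightarrow> s' y = s1 y"
    then have "input_ok s'" "relaxed {} (\<lambda>u v. s' ''D'' [u, v]) (s' ''D'')"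
      using in1 input_ok_cong[of s1 s'] by (simp_all add: relaxed_def dist_upto_def)
    from runs_relax_u[OF this] show "runs ?c s' (For_time n (For_time n (For_time n 2)))
        (\<lambda>s''. dist_upto (Suc i) (upd s'' ''r'' (Suc i) ''D''))"
      by (rule runs_mono) (use dist_upto_Suc[OF s'(2)] in auto)
  qed (use in1 \<open>dist_upto 0 (s1 ''D'')\<close> in simp_all)
  then show "runs (For ''r'' (Var ''n'') ?c) s1 (For_time n (For_time n (For_time n (For_time n 2))))
    (\<lambda>s'. dist_ok (s' ''D''))"
    by (rule runs_mono) (auto simp: dist_upto_def dist_ok_def less less_imp_le)
qed

end


section \<open>Greedy points\<close>

definition argmax :: com where
  "argmax = Seq (Assign ''x'' [] (N 0))
    (For ''v'' (Var ''n'') (If (Less (V ''M'' [Var ''x'']) (V ''M'' [Var ''v'']))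
      (Assign ''x'' [] (Var ''v'')) Skip))"

text \<open>\<open>M\<close> holds twice the minimal Gromov product over the points chosen so far,
  so only the value for the newest point, computed in \<open>t\<close>, has to be compared.\<close>

definition update_M :: com where
  "update_M = For ''v'' (Var ''n'') (Seq
    (Assign ''t'' [] (Minus (Plus (V ''D'' [V ''X'' [N 0], Var ''v'']) (V ''D'' [Var ''v'', Var ''x'']))
      (V ''D'' [V ''X'' [N 0], Var ''x''])))
    (If (Less (Var ''t'') (V ''M'' [Var ''v''])) (Assign ''M'' [Var ''v''] (Var ''t'')) Skip))"

text \<open>\<open>M\<close> first holds the distances from vertex 0, so that \<open>argmax\<close>
  finds a farthest vertex. It is then overwritten by twice the distance to that vertex, the doubled
  Gromov product for \<open>j = 0\<close>.\<close>

definition greedy_start :: com where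
  "greedy_start = Seq (For ''v'' (Var ''n'') (Assign ''M'' [Var ''v''] (V ''D'' [N 0, Var ''v''])))
    (Seq argmax (Seq (Assign ''X'' [N 0] (Var ''x''))
      (For ''v'' (Var ''n'') (Assign ''M'' [Var ''v'']
        (Plus (V ''D'' [Var ''x'', Var ''v'']) (V ''D'' [Var ''v'', Var ''x'']))))))"

definition greedy_step :: com where
  "greedy_step = Seq argmax (Seq (Assign ''X'' [Plus (Var ''i'') (N 1)] (Var ''x'')) update_M)"

text \<open>Iteration \<open>i\<close> writes entry \<open>i + 1\<close> of \<open>X\<close>, so
  \<open>2 * k\<close> iterations after the start yield \<open>2 * k + 1\<close> points.\<close>

definition greedy :: com where
  "greedy = Seq greedy_start (For ''i'' (Plus (Var ''k'') (Var ''k'')) greedy_step)"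

lemma wvars_greedy_parts [simp]:
  "wvars argmax = {''x'', ''v''}" "wvars update_M = {''v'', ''t'', ''M''}"
  "wvars greedy_start = {''v'', ''M'', ''x'', ''X''}"
  "wvars greedy_step = {''v'', ''M'', ''x'', ''X'', ''t''}"
  by (auto simp: argmax_def update_M_def greedy_start_def greedy_step_def)

lemma wvars_greedy [simp]: "wvars greedy = {''i'', ''v'', ''M'', ''x'', ''X'', ''t''}"
  by (auto simp: greedy_def)

definition greedy_time :: "nat \<Rightarrow> nat \<Rightarrow> nat" where
  "greedy_time n k = (For_time n 1 + ((1 + For_time n 2) + (1 + For_time n 1))) +
    For_time (k + k) (1 + For_time n 2 + (1 + For_time n 3))"

context gc_input
begin

lemma runs_argmax:
  assumes "input_ok s"
  shows "runs argmax s (1 + For_time n 2)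
    (\<lambda>s'. s' ''x'' [] < n \<and> (\<forall>v<n. s ''M'' [v] \<le> s ''M'' [s' ''x'' []]))"
  unfolding argmax_def
proof (rule runs_Seq[OF runs_frame])
  show "runs (Assign ''x'' [] (N 0)) s 1 (\<lambda>s'. s' ''x'' [] = 0)"
    by (intro runs_Assign) simp
next
  fix s1
  assume s1: "s1 ''x'' [] = 0 \<and> (\<forall>x. x \<notin> wvars (Assign ''x'' [] (N 0)) \<longrightarrow> s1 x = s x)"
  let ?c = "If (Less (V ''M'' [Var ''x'']) (V ''M'' [Var ''v''])) (Assign ''x'' [] (Var ''v'')) Skip"
  let ?I = "\<lambda>i s'. s' ''x'' [] < n \<and> (\<forall>v<i. s ''M'' [v] \<le> s ''M'' [s' ''x'' []])"
  show "runs (For ''v'' (Var ''n'') ?c) s1 (For_time n 2) (?I n)"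
  proof (rule runs_For'[where I = ?I])
    fix i s'
    assume s': "i < n" "?I i s'" "s' ''v'' [] = i" "\<And>y. y \<notin> wvars (For ''v'' (Var ''n'') ?c) \<Longrightarrow> s' y = s1 y"
    have M: "s' ''M'' = s ''M''"
      using s'(4) s1 by simp
    have "s ''M'' [v] \<le> s ''M'' [i]" if "s ''M'' [s' ''x'' []] < s ''M'' [i]" "v < i" for v
      using s'(2) that by (meson le_less_trans less_imp_le)
    then show "runs ?c s' 2 (\<lambda>s''. ?I (Suc i) (upd s'' ''v'' (Suc i)))"
      using s'(1-3) M by (intro runs_straight) (simp_all add: less_Suc_eq not_less)
  qed (use assms s1 n_pos in simp_all)
qed

lemma runs_update_M:
  assumes "input_ok s" "dist_ok (s ''D'')" "s ''x'' [] = y" "s ''X'' [0] = a" "y < n" "a < n"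
  shows "runs update_M s (For_time n 3)
    (\<lambda>s'. \<forall>v<n. s' ''M'' [v] = min (s ''M'' [v]) (d a v + d v y - d a y))"
  unfolding update_M_def
proof (rule runs_mono[OF runs_For'])
  let ?c = "Seq
    (Assign ''t'' [] (Minus (Plus (V ''D'' [V ''X'' [N 0], Var ''v'']) (V ''D'' [Var ''v'', Var ''x'']))
      (V ''D'' [V ''X'' [N 0], Var ''x''])))
    (If (Less (Var ''t'') (V ''M'' [Var ''v''])) (Assign ''M'' [Var ''v''] (Var ''t'')) Skip)"
  let ?I = "\<lambda>i s'. \<forall>v. s' ''M'' [v] = (if v < i then min (s ''M'' [v]) (d a v + d v y - d a y) else s ''M'' [v])"
  show "?I 0 (upd s ''v'' 0)"
    by simp
  fix i s'
  assume s': "i < n" "?I i s'" "s' ''v'' [] = i" "\<And>y. y \<notin> wvars (For ''v'' (Var ''n'') ?c) \<Longrightarrow> s' y = s y"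
  have "s' ''D'' = s ''D''" "s' ''X'' = s ''X''" "s' ''x'' = s ''x''"
    using s'(4) by simp_all
  then show "runs ?c s' 3 (\<lambda>s''. ?I (Suc i) (upd s'' ''v'' (Suc i)))"
    using assms s'(1-3) by (intro runs_straight) (auto simp: less_Suc_eq min_def)
qed (use assms in simp_all)

definition greedy_state :: "nat \<Rightarrow> (nat \<Rightarrow> nat) \<Rightarrow> (nat \<Rightarrow> nat) \<Rightarrow> bool" where
  "greedy_state i x M \<longleftrightarrow> greedy_sequence G 0 i x \<and>
    (\<forall>v<n. (\<exists>j\<le>i. M v = tree_dist G x j v) \<and> (\<forall>j\<le>i. M v \<le> tree_dist G x j v))"

lemma greedy_state_Suc:
  assumes state: "greedy_state i x M" and y: "y < n" "\<And>v. v < n \<Longrightarrow> M v \<le> M y"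
    and M': "\<And>v. v < n \<Longrightarrow> M' v = min (M v) (d (x 0) v + d v y - d (x 0) y)"
  shows "greedy_state (Suc i) (x(Suc i := y)) M'"
proof -
  let ?x = "x(Suc i := y)"
  have td: "tree_dist G ?x j v = tree_dist G x j v" if "j \<le> i" for j v
    using that by (simp add: tree_dist_def)
  have td': "tree_dist G ?x (Suc i) v = d (x 0) v + d v y - d (x 0) y" for v
    by (simp add: tree_dist_def)
  have greedy: "greedy_sequence G 0 i x"
    and M: "\<And>v. v < n \<Longrightarrow> \<exists>j\<le>i. M v = tree_dist G x j v" "\<And>v j. v < n \<Longrightarrow> j \<le> i \<Longrightarrow> M v \<le> tree_dist G x j v"
    using state by (auto simp: greedy_state_def)
  have "\<exists>m. (\<forall>j<l. m \<le> tree_dist G ?x j (?x l)) \<and> (\<forall>v\<in>pverts G. \<exists>j<l. tree_dist G ?x j v \<le> m)"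
    if l: "l \<in> {1..Suc i}" for l
  proof (cases "l = Suc i")
    case True
    \<comment> \<open>\<open>M y\<close> serves as \<open>m\<close>: it is a lower bound at
      \<open>y\<close>, and each \<open>M v\<close>, attained by some \<open>j \<le> i\<close>, is
      at most \<open>M y\<close>.\<close>
    have "\<exists>j<l. tree_dist G ?x j v \<le> M y" if "v < n" for v
      using M(1)[OF that] y(2)[OF that] td True by (metis less_Suc_eq_le)
    then show ?thesis
      using M(2)[OF y(1)] td True by (intro exI[of _ "M y"]) (auto simp: less_Suc_eq_le)
  next
    case False
    then have "l \<in> {1..i}"
      using l by auto
    then obtain m where "\<forall>j<l. m \<le> tree_dist G x j (x l)" "\<forall>v\<in>pverts G. \<exists>j<l. tree_dist G x j v \<le> m"
      using greedy unfolding greedy_sequence_def by blast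
    then show ?thesis
      using td \<open>l \<in> {1..i}\<close> by (intro exI[of _ m]) force
  qed
  then have "greedy_sequence G 0 (Suc i) ?x"
    using greedy y(1) unfolding greedy_sequence_def by (auto simp: le_Suc_eq)
  moreover have "(\<exists>j\<le>Suc i. M' v = tree_dist G ?x j v) \<and> (\<forall>j\<le>Suc i. M' v \<le> tree_dist G ?x j v)"
    if v: "v < n" for v
  proof
    obtain j where "j \<le> i" "M v = tree_dist G x j v"
      using M(1)[OF v] by blast
    then show "\<exists>j\<le>Suc i. M' v = tree_dist G ?x j v"
      using M'[OF v] td td' by (metis le_SucI min_def order_refl)
    show "\<forall>j\<le>Suc i. M' v \<le> tree_dist G ?x j v"
      using M'[OF v] td td' M(2)[OF v] by (auto simp: le_Suc_eq min_le_iff_disj simp del: fun_upd_apply)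
  qed
  ultimately show ?thesis
    by (simp add: greedy_state_def)
qed

lemma runs_greedy_start:
  assumes "input_ok s" "dist_ok (s ''D'')"
  shows "runs greedy_start s (For_time n 1 + ((1 + For_time n 2) + (1 + For_time n 1)))
    (\<lambda>s'. greedy_state 0 (\<lambda>j. s' ''X'' [j]) (\<lambda>v. s' ''M'' [v]))"
  unfolding greedy_start_def
proof (rule runs_Seq[OF runs_frame])
  let ?c = "Assign ''M'' [Var ''v''] (V ''D'' [N 0, Var ''v''])"
  show "runs (For ''v'' (Var ''n'') ?c) s (For_time n 1) (\<lambda>s'. \<forall>v<n. s' ''M'' [v] = d 0 v)"
  proof (rule runs_For'[where I = "\<lambda>i s'. \<forall>v<i. s' ''M'' [v] = d 0 v"])
    fix i s'
    assume "i < n" "\<forall>v<i. s' ''M'' [v] = d 0 v" "s' ''v'' [] = i"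
       "\<And>y. y \<notin> wvars (For ''v'' (Var ''n'') ?c) \<Longrightarrow> s' y = s y"
    then show "runs ?c s' 1 (\<lambda>s''. \<forall>v<Suc i. upd s'' ''v'' (Suc i) ''M'' [v] = d 0 v)"
      using assms n_pos by (intro runs_Assign) (simp add: less_Suc_eq)
  qed (use assms in simp_all)
next
  fix s1
  assume s1: "(\<forall>v<n. s1 ''M'' [v] = d 0 v) \<and>
    (\<forall>x. x \<notin> wvars (For ''v'' (Var ''n'') (Assign ''M'' [Var ''v''] (V ''D'' [N 0, Var ''v'']))) \<longrightarrow> s1 x = s x)"
  then have in1: "input_ok s1"
    using assms input_ok_cong[of s s1] by simp
  let ?c = "Assign ''M'' [Var ''v''] (Plus (V ''D'' [Var ''x'', Var ''v'']) (V ''D'' [Var ''v'', Var ''x'']))"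
  show "runs (Seq argmax (Seq (Assign ''X'' [N 0] (Var ''x'')) (For ''v'' (Var ''n'') ?c))) s1
    (1 + For_time n 2 + (1 + For_time n 1)) (\<lambda>s'. greedy_state 0 (\<lambda>j. s' ''X'' [j]) (\<lambda>v. s' ''M'' [v]))"
  proof (rule runs_Seq[OF runs_frame[OF runs_argmax[OF in1]]], rule runs_Seq[OF runs_frame])
    fix s2
    assume s2: "(s2 ''x'' [] < n \<and> (\<forall>v<n. s1 ''M'' [v] \<le> s1 ''M'' [s2 ''x'' []])) \<and>
      (\<forall>x. x \<notin> wvars argmax \<longrightarrow> s2 x = s1 x)"
    show "runs (Assign ''X'' [N 0] (Var ''x'')) s2 1 (\<lambda>s'. s' ''X'' [0] = s2 ''x'' [])"
      by (intro runs_Assign) simp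
    fix s3
    assume s3: "s3 ''X'' [0] = s2 ''x'' [] \<and> (\<forall>x. x \<notin> wvars (Assign ''X'' [N 0] (Var ''x'')) \<longrightarrow> s3 x = s2 x)"
    let ?a = "s2 ''x'' []"
    have M1: "s1 ''M'' [v] = d 0 v" if "v < n" for v
      using s1 that by blast
    have a: "?a < n"
      using s2 by blast
    have far: "d 0 v \<le> d 0 ?a" if "v < n" for v
      using s2 that M1[OF that] M1[OF a] by metis
    have s3': "s3 ''x'' [] = ?a" "s3 ''D'' = s ''D''" "s3 ''n'' = s ''n''" "s3 ''X'' [0] = ?a"
      using s1 s2 s3 by simp_all
    let ?I = "\<lambda>i s'. \<forall>v<i. s' ''M'' [v] = d ?a v + d v ?a"
    have "runs (For ''v'' (Var ''n'') ?c) s3 (For_time n 1) (?I n)"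
    proof (rule runs_For'[where I = ?I])
      fix i s'
      assume "i < n" "?I i s'" "s' ''v'' [] = i" "\<And>y. y \<notin> wvars (For ''v'' (Var ''n'') ?c) \<Longrightarrow> s' y = s3 y"
      then show "runs ?c s' 1 (\<lambda>s''. ?I (Suc i) (upd s'' ''v'' (Suc i)))"
        using assms s3' a by (intro runs_Assign) (simp add: less_Suc_eq)
    qed (use assms s3' in simp_all)
    then show "runs (For ''v'' (Var ''n'') ?c) s3 (For_time n 1)
        (\<lambda>s'. greedy_state 0 (\<lambda>j. s' ''X'' [j]) (\<lambda>v. s' ''M'' [v]))"
    proof (rule runs_mono[OF runs_frame])
      fix s'
      assume s': "?I n s' \<and> (\<forall>x. x \<notin> wvars (For ''v'' (Var ''n'') ?c) \<longrightarrow> s' x = s3 x)"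
      then have "s' ''X'' [0] = ?a"
        using s3' by simp
      then show "greedy_state 0 (\<lambda>j. s' ''X'' [j]) (\<lambda>v. s' ''M'' [v])"
        using a far s' gdist_refl[of ?a] by (simp add: greedy_state_def greedy_sequence_def tree_dist_def)
    qed simp
  qed
qed

lemma runs_greedy_step:
  assumes "input_ok s" "dist_ok (s ''D'')" "s ''i'' [] = i" "greedy_state i (\<lambda>j. s ''X'' [j]) (\<lambda>v. s ''M'' [v])"
  shows "runs greedy_step s (1 + For_time n 2 + (1 + For_time n 3))
    (\<lambda>s'. greedy_state (Suc i) (\<lambda>j. s' ''X'' [j]) (\<lambda>v. s' ''M'' [v]))"
  unfolding greedy_step_def
proof (rule runs_Seq[OF runs_frame[OF runs_argmax[OF assms(1)]]], rule runs_Seq)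
  fix s1
  assume s1: "(s1 ''x'' [] < n \<and> (\<forall>v<n. s ''M'' [v] \<le> s ''M'' [s1 ''x'' []])) \<and>
    (\<forall>x. x \<notin> wvars argmax \<longrightarrow> s1 x = s x)"
  let ?y = "s1 ''x'' []"
  let ?s = "s1(''X'' := (s1 ''X'')([Suc i] := ?y))"
  show "runs (Assign ''X'' [Plus (Var ''i'') (N 1)] (Var ''x'')) s1 1 (\<lambda>s'. s' = ?s)"
    using s1 assms(3) by (intro runs_Assign) simp
  fix s2
  assume s2_def: "s2 = ?s"
  have eq: "s1 ''D'' = s ''D''" "s1 ''M'' = s ''M''" "s1 ''X'' = s ''X''" "s1 ''n'' = s ''n''"
    "s1 ''k'' = s ''k''" "s1 ''adj'' = s ''adj''"
    using s1 by simp_all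
  have s2: "input_ok s2" "dist_ok (s2 ''D'')" "s2 ''x'' [] = ?y" "s2 ''X'' [0] = s ''X'' [0]"
    "s2 ''M'' = s ''M''" "(\<lambda>j. s2 ''X'' [j]) = (\<lambda>j. s ''X'' [j])(Suc i := ?y)"
    unfolding s2_def using assms(1,2) input_ok_cong[of s ?s] by (simp_all add: eq fun_eq_iff)
  have "s ''X'' [0] < n"
    using assms(4) by (auto simp: greedy_state_def greedy_sequence_def)
  from runs_frame[OF runs_update_M[OF s2(1-4) _ this]] s1
  have "runs update_M s2 (For_time n 3)
     (\<lambda>s'. (\<forall>v<n. s' ''M'' [v] = min (s2 ''M'' [v]) (d (s ''X'' [0]) v + d v ?y - d (s ''X'' [0]) ?y)) \<and>
        (\<forall>x. x \<notin> wvars update_M \<longrightarrow> s' x = s2 x))"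
    by simp
  then show "runs update_M s2 (For_time n 3)
      (\<lambda>s'. greedy_state (Suc i) (\<lambda>j. s' ''X'' [j]) (\<lambda>v. s' ''M'' [v]))"
  proof (rule runs_mono)
    fix s'
    assume s': "(\<forall>v<n. s' ''M'' [v] = min (s2 ''M'' [v]) (d (s ''X'' [0]) v + d v ?y - d (s ''X'' [0]) ?y)) \<and>
        (\<forall>x. x \<notin> wvars update_M \<longrightarrow> s' x = s2 x)"
    then have "s' ''X'' = s2 ''X''"
      by simp
    then show "greedy_state (Suc i) (\<lambda>j. s' ''X'' [j]) (\<lambda>v. s' ''M'' [v])"
      using greedy_state_Suc[OF assms(4), of ?y "\<lambda>v. s' ''M'' [v]"] s1 s' s2(5,6) by simp
  qed simp
qed

lemma runs_greedy:
  assumes "input_ok s" "dist_ok (s ''D'')"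
  shows "runs greedy s (greedy_time n k) (\<lambda>s'. greedy_sequence G 0 (2 * k) (\<lambda>j. s' ''X'' [j]))"
  unfolding greedy_def greedy_time_def
proof (rule runs_Seq[OF runs_frame[OF runs_greedy_start[OF assms]]])
  fix s1
  assume s1: "greedy_state 0 (\<lambda>j. s1 ''X'' [j]) (\<lambda>v. s1 ''M'' [v]) \<and> (\<forall>x. x \<notin> wvars greedy_start \<longrightarrow> s1 x = s x)"
  have "runs (For ''i'' (Plus (Var ''k'') (Var ''k'')) greedy_step) s1
    (For_time (k + k) (1 + For_time n 2 + (1 + For_time n 3)))
    (\<lambda>s'. greedy_state (k + k) (\<lambda>j. s' ''X'' [j]) (\<lambda>v. s' ''M'' [v]))"
  proof (rule runs_For'[where I = "\<lambda>i s'. greedy_state i (\<lambda>j. s' ''X'' [j]) (\<lambda>v. s' ''M'' [v])"])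
    fix i s'
    assume s': "greedy_state i (\<lambda>j. s' ''X'' [j]) (\<lambda>v. s' ''M'' [v])" "s' ''i'' [] = i"
      "\<And>y. y \<notin> wvars (For ''i'' (Plus (Var ''k'') (Var ''k'')) greedy_step) \<Longrightarrow> s' y = s1 y"
    then have "input_ok s'" "dist_ok (s' ''D'')"
      using assms s1 input_ok_cong[of s s'] by simp_all
    from runs_greedy_step[OF this s'(2,1)]
    show "runs greedy_step s' (1 + For_time n 2 + (1 + For_time n 3)) (\<lambda>s''. greedy_state (Suc i)
        (\<lambda>j. upd s'' ''i'' (Suc i) ''X'' [j]) (\<lambda>v. upd s'' ''i'' (Suc i) ''M'' [v]))"
      by simp
  qed (use assms s1 in simp_all)
  then show "runs (For ''i'' (Plus (Var ''k'') (Var ''k'')) greedy_step) s1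
    (For_time (k + k) (1 + For_time n 2 + (1 + For_time n 3)))
    (\<lambda>s'. greedy_sequence G 0 (2 * k) (\<lambda>j. s' ''X'' [j]))"
    by (rule runs_mono) (simp_all add: greedy_state_def mult_2)
qed

end


section \<open>Local search for a pairing\<close>

definition initial_pairs :: com where
  "initial_pairs = For ''i'' (Var ''k'') (Seq (Assign ''A'' [Var ''i''] (V ''X'' [Var ''i'']))
    (Assign ''B'' [Var ''i''] (V ''X'' [Plus (Var ''k'') (Var ''i'')])))"

definition improve :: com where
  "improve =
    (let Ai = V ''A'' [Var ''i'']; Bi = V ''B'' [Var ''i'']; Aj = V ''A'' [Var ''j'']; Bj = V ''B'' [Var ''j''];
      D = (\<lambda>e e'. V ''D'' [e, e']); old = Plus (D Ai Bi) (D Aj Bj)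
     in If (Less old (Plus (D Ai Bj) (D Aj Bi)))
       (Seq (Assign ''t'' [] Bi) (Seq (Assign ''B'' [Var ''i''] Bj)
         (Seq (Assign ''B'' [Var ''j''] (Var ''t'')) (Assign ''changed'' [] (N 1)))))
       (If (Less old (Plus (D Ai Aj) (D Bi Bj)))
         (Seq (Assign ''t'' [] Bi) (Seq (Assign ''B'' [Var ''i''] Aj)
           (Seq (Assign ''A'' [Var ''j''] (Var ''t'')) (Assign ''changed'' [] (N 1)))))
         Skip))"

definition improve_round :: com where
  "improve_round = Seq (Assign ''changed'' [] (N 0)) (For ''i'' (Var ''k'') (For ''j'' (Var ''k'') improve))"

definition pair_up :: com where
  "pair_up = Seq initial_pairs (Seq (Assign ''changed'' [] (N 1))
    (While (Less (N 0) (Var ''changed'')) improve_round))"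

lemma wvars_pair_up_parts [simp]:
  "wvars initial_pairs = {''i'', ''A'', ''B''}" "wvars improve = {''t'', ''A'', ''B'', ''changed''}"
  "wvars improve_round = {''i'', ''j'', ''t'', ''A'', ''B'', ''changed''}"
  by (auto simp: initial_pairs_def improve_def improve_round_def Let_def)

lemma wvars_pair_up [simp]: "wvars pair_up = {''i'', ''j'', ''t'', ''A'', ''B'', ''changed''}"
  by (auto simp: pair_up_def)

definition pair_up_time :: "nat \<Rightarrow> nat \<Rightarrow> nat" where
  "pair_up_time n k = For_time k 2 + (1 + (1 + (1 + k * n) * (1 + (1 + For_time k (For_time k 6)))))"

context gc_input
begin

text \<open>Stated by values instead of a bijection of indices, since the points \<open>x j\<close>
  may coincide. The first \<open>2 * k\<close> points are paired, as in the hypotheses of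
  \<open>approximation\<close>.\<close>

definition pairing :: "(nat \<Rightarrow> nat) \<Rightarrow> (nat \<Rightarrow> nat) \<Rightarrow> (nat \<Rightarrow> nat) \<Rightarrow> bool" where
  "pairing x A B \<longleftrightarrow> (\<forall>i<k. A i < n \<and> B i < n) \<and> (\<forall>j<2*k. \<exists>i<k. x j = A i \<or> x j = B i)"

definition weight :: "(nat \<Rightarrow> nat) \<Rightarrow> (nat \<Rightarrow> nat) \<Rightarrow> nat" where
  "weight A B = (\<Sum>i<k. d (A i) (B i))"

definition stable_at :: "(nat \<Rightarrow> nat) \<Rightarrow> (nat \<Rightarrow> nat) \<Rightarrow> nat \<Rightarrow> nat \<Rightarrow> bool" where
  "stable_at A B i j \<longleftrightarrow>
    d (A i) (B j) + d (A j) (B i) \<le> d (A i) (B i) + d (A j) (B j) \<and>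
    d (A i) (A j) + d (B i) (B j) \<le> d (A i) (B i) + d (A j) (B j)"

lemma weight_le: "pairing x A B \<Longrightarrow> weight A B \<le> k * n"
  using sum_bounded_above[of "{..<k}" "\<lambda>i. d (A i) (B i)" n] gdist_less_card
  by (simp add: weight_def pairing_def less_imp_le)

lemma weight_less:
  assumes ij: "i < k" "j < k" "i \<noteq> j"
    and same: "\<And>l. l \<noteq> i \<Longrightarrow> l \<noteq> j \<Longrightarrow> A' l = A l \<and> B' l = B l"
    and less: "d (A i) (B i) + d (A j) (B j) < d (A' i) (B' i) + d (A' j) (B' j)"
  shows "weight A B < weight A' B'"
proof -
  have split: "(\<Sum>l<k. f l) = f i + f j + (\<Sum>l\<in>{..<k} - {i} - {j}. f l)" for f :: "nat \<Rightarrow> nat"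
    using ij by (simp add: sum.remove[of "{..<k}" i] sum.remove[of "{..<k} - {i}" j])
  have "(\<Sum>l\<in>{..<k} - {i} - {j}. d (A l) (B l)) = (\<Sum>l\<in>{..<k} - {i} - {j}. d (A' l) (B' l))"
    using same by (intro sum.cong) auto
  then show ?thesis
    unfolding weight_def split[of "\<lambda>l. d (A l) (B l)"] split[of "\<lambda>l. d (A' l) (B' l)"]
    using less by linarith
qed

text \<open>State of a round that began with weight \<open>w\<close>. While the flag
  \<open>c\<close> is 0, the weight is unchanged and all index pairs scanned so far are stable;
  after an exchange only the gain in weight is recorded, as another round will follow.\<close>

definition scanned :: "(nat \<times> nat) set \<Rightarrow> nat \<Rightarrow> (nat \<Rightarrow> nat) \<Rightarrow> (nat \<Rightarrow> nat) \<Rightarrow> (nat \<Rightarrow> nat) \<Rightarrow> nat \<Rightarrow> bool" where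
  "scanned S w x A B c \<longleftrightarrow> pairing x A B \<and>
    (if c = 0 then weight A B = w \<and> (\<forall>(i, j)\<in>S. stable_at A B i j) else w < weight A B)"

lemma scanned_swap:
  assumes "scanned S w x A B c" "i < k" "j < k" "pairing x A' B'"
    and "\<And>l. l \<noteq> i \<Longrightarrow> l \<noteq> j \<Longrightarrow> A' l = A l \<and> B' l = B l" "i \<noteq> j"
    and "d (A i) (B i) + d (A j) (B j) < d (A' i) (B' i) + d (A' j) (B' j)"
  shows "scanned S' w x A' B' 1"
  using assms weight_less[of i j A' A B' B] by (auto simp: scanned_def split: if_splits)

lemma scanned_swap_BB:
  assumes scan: "scanned S w x A B c" and ij: "i < k" "j < k"
    and less: "d (A i) (B i) + d (A j) (B j) < d (A i) (B j) + d (A j) (B i)"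
  shows "scanned S' w x A (B(i := B j, j := B i)) 1"
proof (rule scanned_swap[OF scan ij])
  show neq: "i \<noteq> j"
    using less by auto
  have "pairing x A B"
    using scan by (simp add: scanned_def)
  then have "\<forall>l<2*k. \<exists>i'<k. x l = A i' \<or> x l = (B(i := B j, j := B i)) i'"
    using ij neq unfolding pairing_def by (metis fun_upd_apply)
  with \<open>pairing x A B\<close> show "pairing x A (B(i := B j, j := B i))"
    using ij by (simp add: pairing_def)
qed (use less in auto)

lemma scanned_swap_BA:
  assumes scan: "scanned S w x A B c" and ij: "i < k" "j < k"
    and less: "d (A i) (B i) + d (A j) (B j) < d (A i) (A j) + d (B i) (B j)"
  shows "scanned S' w x (A(j := B i)) (B(i := A j)) 1"
proof -
  have p: "pairing x A B"
    using scan by (simp add: scanned_def)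
  \<comment> \<open>For \<open>i = j\<close> the right-hand side of \<open>less\<close> would be a
    sum of two zero distances.\<close>
  then have neq: "i \<noteq> j"
    using less ij gdist_refl[of "A i"] gdist_refl[of "B i"] by (auto simp: pairing_def)
  have "\<forall>l<2*k. \<exists>i'<k. x l = (A(j := B i)) i' \<or> x l = (B(i := A j)) i'"
    using p ij neq unfolding pairing_def by (metis fun_upd_apply)
  with p have "pairing x (A(j := B i)) (B(i := A j))"
    using ij by (simp add: pairing_def)
  then show ?thesis
    using less neq by (intro scanned_swap[OF scan ij]) auto
qed

lemma scanned_keep:
  assumes "scanned S w x A B c" "stable_at A B i j"
  shows "scanned (insert (i, j) S) w x A B c"
  using assms by (auto simp: scanned_def split: if_splits)

abbreviation scanned_state :: "(nat \<times> nat) set \<Rightarrow> nat \<Rightarrow> (nat \<Rightarrow> nat) \<Rightarrow> state \<Rightarrow> bool" where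
  "scanned_state S w x s \<equiv> scanned S w x (\<lambda>a. s ''A'' [a]) (\<lambda>a. s ''B'' [a]) (s ''changed'' [])"

lemma runs_improve:
  assumes D: "dist_ok (s ''D'')" and s: "s ''i'' [] = i" "s ''j'' [] = j" and ij: "i < k" "j < k"
    and scan: "scanned_state S w x s"
  shows "runs improve s 6 (scanned_state (insert (i, j) S) w x)"
proof (rule runs_straight)
  let ?A = "\<lambda>a. s ''A'' [a]" and ?B = "\<lambda>a. s ''B'' [a]"
  let ?A' = "\<lambda>a. sem improve s ''A'' [a]" and ?B' = "\<lambda>a. sem improve s ''B'' [a]"
  let ?c' = "sem improve s ''changed'' []"
  have n: "?A i < n" "?A j < n" "?B i < n" "?B j < n"
    using scan ij by (auto simp: scanned_def pairing_def)
  consider (BB) "d (?A i) (?B i) + d (?A j) (?B j) < d (?A i) (?B j) + d (?A j) (?B i)"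
    | (BA) "\<not> d (?A i) (?B i) + d (?A j) (?B j) < d (?A i) (?B j) + d (?A j) (?B i)"
      "d (?A i) (?B i) + d (?A j) (?B j) < d (?A i) (?A j) + d (?B i) (?B j)"
    | (keep) "\<not> d (?A i) (?B i) + d (?A j) (?B j) < d (?A i) (?B j) + d (?A j) (?B i)"
      "\<not> d (?A i) (?B i) + d (?A j) (?B j) < d (?A i) (?A j) + d (?B i) (?B j)"
    by blast
  then show "scanned_state (insert (i, j) S) w x (sem improve s)"
  proof cases
    case BB
    then have "?A' = ?A" "?B' = ?B(i := ?B j, j := ?B i)" "?c' = 1"
      using D s n by (auto simp: improve_def Let_def fun_eq_iff)
    then show ?thesis
      using scanned_swap_BB[OF scan ij BB] by (simp only:)
  next
    case BA
    then have "?A' = ?A(j := ?B i)" "?B' = ?B(i := ?A j)" "?c' = 1"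
      using D s n by (auto simp: improve_def Let_def fun_eq_iff)
    then show ?thesis
      using scanned_swap_BA[OF scan ij BA(2)] by (simp only:)
  next
    case keep
    then have "sem improve s = s"
      using D s n by (auto simp: improve_def Let_def)
    then show ?thesis
      using scanned_keep[OF scan] keep by (simp add: stable_at_def not_less)
  qed
qed (simp_all add: improve_def Let_def)

lemma runs_improve_j:
  assumes "input_ok s" "dist_ok (s ''D'')" "s ''i'' [] = i" "i < k" "scanned_state S w x s"
  shows "runs (For ''j'' (Var ''k'') improve) s (For_time k 6) (scanned_state (S \<union> {i} \<times> {..<k}) w x)"
proof (rule runs_For'[where I = "\<lambda>j. scanned_state (S \<union> {i} \<times> {..<j}) w x"])
  fix j s'
  assume s': "j < k" "scanned_state (S \<union> {i} \<times> {..<j}) w x s'" "s' ''j'' [] = j"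
    "\<And>y. y \<notin> wvars (For ''j'' (Var ''k'') improve) \<Longrightarrow> s' y = s y"
  have "insert (i, j) (S \<union> {i} \<times> {..<j}) = S \<union> {i} \<times> {..<Suc j}"
    by auto
  then show "runs improve s' 6 (\<lambda>s''. scanned_state (S \<union> {i} \<times> {..<Suc j}) w x (upd s'' ''j'' (Suc j)))"
    using runs_improve[OF _ _ s'(3) assms(4) s'(1,2)] assms s' by simp
qed (use assms in simp_all)

lemma runs_improve_round:
  assumes "input_ok s" "dist_ok (s ''D'')" "pairing x (\<lambda>a. s ''A'' [a]) (\<lambda>a. s ''B'' [a])"
  shows "runs improve_round s (1 + For_time k (For_time k 6))
    (scanned_state ({..<k} \<times> {..<k}) (weight (\<lambda>a. s ''A'' [a]) (\<lambda>a. s ''B'' [a])) x)"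
  unfolding improve_round_def
proof (rule runs_Seq)
  let ?s = "upd s ''changed'' 0"
  let ?w = "weight (\<lambda>a. s ''A'' [a]) (\<lambda>a. s ''B'' [a])"
  show "runs (Assign ''changed'' [] (N 0)) s 1 (\<lambda>s'. s' = ?s)"
    by (intro runs_Assign) (simp add: upd_def)
  fix s1
  assume s1: "s1 = ?s"
  then have in1: "input_ok s1"
    using assms input_ok_cong[of s s1] by simp
  have scan: "scanned_state {} ?w x s1"
    using assms(3) s1 by (simp add: scanned_def)
  let ?c = "For ''j'' (Var ''k'') improve"
  show "runs (For ''i'' (Var ''k'') ?c) s1 (For_time k (For_time k 6))
      (scanned_state ({..<k} \<times> {..<k}) ?w x)"
  proof (rule runs_For'[where I = "\<lambda>i. scanned_state ({..<i} \<times> {..<k}) ?w x"])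
    fix i s'
    assume s': "i < k" "scanned_state ({..<i} \<times> {..<k}) ?w x s'" "s' ''i'' [] = i"
      "\<And>y. y \<notin> wvars (For ''i'' (Var ''k'') ?c) \<Longrightarrow> s' y = s1 y"
    have "{..<i} \<times> {..<k} \<union> {i} \<times> {..<k} = {..<Suc i} \<times> {..<k}"
      by auto
    then show "runs ?c s' (For_time k 6) (\<lambda>s''. scanned_state ({..<Suc i} \<times> {..<k}) ?w x (upd s'' ''i'' (Suc i)))"
      using runs_improve_j[OF _ _ s'(3,1,2)] in1 s1 assms s' input_ok_cong[of s1 s'] by simp
  qed (use in1 scan in simp_all)
qed

lemma runs_pair_up:
  assumes s: "input_ok s" "dist_ok (s ''D'')" and x: "\<And>j. j < 2 * k \<Longrightarrow> s ''X'' [j] < n"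
  shows "runs pair_up s (pair_up_time n k) (\<lambda>s'.
    pairing (\<lambda>j. s ''X'' [j]) (\<lambda>a. s' ''A'' [a]) (\<lambda>a. s' ''B'' [a]) \<and>
    stable_pairing G k (\<lambda>a. s' ''A'' [a]) (\<lambda>a. s' ''B'' [a]))"
  unfolding pair_up_def pair_up_time_def
proof (rule runs_Seq[OF runs_frame], rule_tac[2] runs_Seq)
  let ?x = "\<lambda>j. s ''X'' [j]"
  let ?pair = "\<lambda>s'. pairing ?x (\<lambda>a. s' ''A'' [a]) (\<lambda>a. s' ''B'' [a])"
  let ?I = "\<lambda>i s'. \<forall>a<i. s' ''A'' [a] = ?x a \<and> s' ''B'' [a] = ?x (k + a)"
  let ?c = "Seq (Assign ''A'' [Var ''i''] (V ''X'' [Var ''i'']))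
    (Assign ''B'' [Var ''i''] (V ''X'' [Plus (Var ''k'') (Var ''i'')]))"
  show "runs initial_pairs s (For_time k 2) (?I k)"
    unfolding initial_pairs_def
  proof (rule runs_For'[where I = ?I])
    fix i s'
    assume s': "i < k" "?I i s'" "s' ''i'' [] = i" "\<And>y. y \<notin> wvars (For ''i'' (Var ''k'') ?c) \<Longrightarrow> s' y = s y"
    have "s' ''X'' = s ''X''" "s' ''k'' [] = k"
      using s'(4) s by simp_all
    then show "runs ?c s' 2 (\<lambda>s''. ?I (Suc i) (upd s'' ''i'' (Suc i)))"
      using s'(1-3) by (intro runs_straight) (simp_all add: less_Suc_eq)
  qed (use s in simp_all)
  fix s1
  assume s1: "?I k s1 \<and> (\<forall>x. x \<notin> wvars initial_pairs \<longrightarrow> s1 x = s x)"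
  have "\<exists>i<k. ?x j = s1 ''A'' [i] \<or> ?x j = s1 ''B'' [i]" if "j < 2 * k" for j
  proof (cases "j < k")
    case False
    then have "j - k < k" "?x j = s1 ''B'' [j - k]"
      using s1 that by auto
    then show ?thesis
      by blast
  qed (use s1 in auto)
  then have pair1: "?pair s1"
    using s1 x by (simp add: pairing_def)
  show "runs (Assign ''changed'' [] (N 1)) s1 1 (\<lambda>s'. s' = upd s1 ''changed'' 1)"
    by (intro runs_Assign) (simp add: upd_def)
  fix s2
  assume s2: "s2 = upd s1 ''changed'' 1"
  let ?J = "\<lambda>s'. input_ok s' \<and> dist_ok (s' ''D'') \<and> ?pair s' \<and>
    (s' ''changed'' [] = 0 \<longrightarrow> stable_pairing G k (\<lambda>a. s' ''A'' [a]) (\<lambda>a. s' ''B'' [a]))"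
  let ?w = "\<lambda>s'. weight (\<lambda>a. s' ''A'' [a]) (\<lambda>a. s' ''B'' [a])"
  \<comment> \<open>The extra 1 pays for the last round, which finds no improvement; every earlier
    round raises the weight, which is at most \<open>k * n\<close>.\<close>
  let ?f = "\<lambda>s'. if s' ''changed'' [] = 0 then 0 else 1 + (k * n - ?w s')"
  have "runs (While (Less (N 0) (Var ''changed'')) improve_round) s2
    (1 + (1 + k * n) * (1 + (1 + For_time k (For_time k 6))))
    (\<lambda>s'. ?J s' \<and> \<not> bval (Less (N 0) (Var ''changed'')) s')"
  proof (rule runs_While[where f = ?f])
    fix s' :: state
    assume J: "?J s'" and "bval (Less (N 0) (Var ''changed'')) s'"
    then have changed: "s' ''changed'' [] \<noteq> 0"
      by simp
    show "runs improve_round s' (1 + For_time k (For_time k 6)) (\<lambda>s''. ?J s'' \<and> ?f s'' < ?f s')"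
    proof (rule runs_mono[OF runs_frame[OF runs_improve_round]])
      fix s''
      assume s'': "scanned_state ({..<k} \<times> {..<k}) (?w s') ?x s'' \<and> (\<forall>x. x \<notin> wvars improve_round \<longrightarrow> s'' x = s' x)"
      then have "input_ok s''" "dist_ok (s'' ''D'')" "?pair s''"
        using J input_ok_cong[of s' s''] by (auto simp: scanned_def)
      moreover have "stable_pairing G k (\<lambda>a. s'' ''A'' [a]) (\<lambda>a. s'' ''B'' [a])" if "s'' ''changed'' [] = 0"
        using s'' that by (auto simp: scanned_def stable_pairing_def stable_at_def)
      moreover have "?f s'' < ?f s'"
      proof (cases "s'' ''changed'' [] = 0")
        case False
        then have "?w s' < ?w s''"
          using conjunct1[OF s''] by (simp add: scanned_def)
        then show ?thesis
          using changed False weight_le[OF \<open>?pair s''\<close>] by simp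
      qed (use changed in simp)
      ultimately show "?J s'' \<and> ?f s'' < ?f s'"
        by blast
    qed (use J in simp_all)
  qed (use s s1 s2 pair1 input_ok_cong[of s s2] in simp_all)
  then show "runs (While (Less (N 0) (Var ''changed'')) improve_round) s2
    (1 + (1 + k * n) * (1 + (1 + For_time k (For_time k 6))))
    (\<lambda>s'. ?pair s' \<and> stable_pairing G k (\<lambda>a. s' ''A'' [a]) (\<lambda>a. s' ''B'' [a]))"
    by (rule runs_mono) auto
qed

end

section \<open>Writing the geodesics\<close>

text \<open>The test reads position \<open>p\<close> while position \<open>p + 1\<close> is written,
  so a later neighbour closer to the target may overwrite an earlier one; any of them continues a
  geodesic.\<close>

definition extend :: com where
  "extend = If (And (Less (N 0) (V ''adj'' [V ''path'' [Var ''i'', Var ''p''], Var ''w'']))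
      (Less (V ''D'' [Var ''w'', V ''B'' [Var ''i'']]) (V ''D'' [V ''path'' [Var ''i'', Var ''p''], V ''B'' [Var ''i'']])))
    (Assign ''path'' [Var ''i'', Plus (Var ''p'') (N 1)] (Var ''w'')) Skip"

definition write_path :: com where
  "write_path = Seq (Assign ''path'' [Var ''i'', N 0] (V ''A'' [Var ''i'']))
    (Seq (Assign ''l'' [] (V ''D'' [V ''A'' [Var ''i''], V ''B'' [Var ''i'']]))
    (Seq (Assign ''len'' [Var ''i''] (Plus (Var ''l'') (N 1)))
      (For ''p'' (Var ''l'') (For ''w'' (Var ''n'') extend))))"

definition write_paths :: com where
  "write_paths = For ''i'' (Var ''k'') write_path"

lemma wvars_write_parts [simp]:
  "wvars extend = {''path''}" "wvars write_path = {''path'', ''l'', ''p'', ''w'', ''len''}"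
  "wvars write_paths = {''i'', ''path'', ''l'', ''p'', ''w'', ''len''}"
  by (auto simp: extend_def write_path_def write_paths_def)

definition write_time :: "nat \<Rightarrow> nat \<Rightarrow> nat" where
  "write_time n k = For_time k (1 + (1 + (1 + For_time n (For_time n 2))))"

context gc_input
begin

lemma runs_extend:
  assumes s: "input_ok s" "dist_ok (s ''D'')" "s ''i'' [] = i" "s ''p'' [] = p" "s ''B'' [i] = b"
      "s ''path'' [i, p] = q"
    and bq: "b < n" "q < n" "d q b = Suc l"
  shows "runs (For ''w'' (Var ''n'') extend) s (For_time n 2) (\<lambda>s'.
    (\<forall>is. is \<noteq> [i, Suc p] \<longrightarrow> s' ''path'' is = s ''path'' is) \<and>
    (q, s' ''path'' [i, Suc p]) \<in> parcs G \<and> d (s' ''path'' [i, Suc p]) b = l)"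
proof -
  define good where "good w \<longleftrightarrow> (q, w) \<in> parcs G \<and> d w b < Suc l" for w
  let ?I = "\<lambda>j s'. (\<forall>is. is \<noteq> [i, Suc p] \<longrightarrow> s' ''path'' is = s ''path'' is) \<and>
    ((\<exists>w<j. good w) \<longrightarrow> good (s' ''path'' [i, Suc p]))"
  have "runs (For ''w'' (Var ''n'') extend) s (For_time n 2) (?I n)"
  proof (rule runs_For'[where I = ?I])
    fix j s'
    assume s': "j < n" "?I j s'" "s' ''w'' [] = j" "\<And>y. y \<notin> wvars (For ''w'' (Var ''n'') extend) \<Longrightarrow> s' y = s y"
    have eq: "s' ''path'' [i, p] = q" "s' ''D'' = s ''D''" "s' ''B'' [i] = b" "s' ''i'' [] = i" "s' ''p'' [] = p"
      "s' ''adj'' = s ''adj''"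
      using s'(2,4) s by simp_all
    show "runs extend s' 2 (\<lambda>s''. ?I (Suc j) (upd s'' ''w'' (Suc j)))"
    proof (rule runs_straight)
      have "bval (And (Less (N 0) (V ''adj'' [V ''path'' [Var ''i'', Var ''p''], Var ''w'']))
        (Less (V ''D'' [Var ''w'', V ''B'' [Var ''i'']]) (V ''D'' [V ''path'' [Var ''i'', Var ''p''], V ''B'' [Var ''i'']])))
        s' \<longleftrightarrow> good j"
        using s(1,2) s'(1,3) eq bq by (simp add: good_def)
      then have "sem extend s' = (if good j then s'(''path'' := (s' ''path'')([i, Suc p] := j)) else s')"
        using s'(3) eq by (simp add: extend_def del: bval.simps)
      then show "?I (Suc j) (upd (sem extend s') ''w'' (Suc j))"
        using s'(2) by (auto simp: less_Suc_eq)
    qed (simp_all add: extend_def)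
  qed (use s in simp_all)
  then show ?thesis
  proof (rule runs_mono)
    fix s'
    assume s': "?I n s'"
    \<comment> \<open>Applied from \<open>b\<close>, \<open>gdist_SucE\<close> yields a neighbour of
      \<open>q\<close> one step closer to \<open>b\<close>, so the search succeeds.\<close>
    obtain w where "(w, q) \<in> parcs G" "d b w = l"
      using gdist_SucE[of b q l] gdist_sym[of b q] bq by auto
    moreover have "w < n"
      using calculation in_arcsD1 by auto
    ultimately have "good w" "w < n"
      using arcs_symmetric gdist_sym[of b w] bq by (simp_all add: good_def)
    then have good: "(q, s' ''path'' [i, Suc p]) \<in> parcs G \<and> d (s' ''path'' [i, Suc p]) b < Suc l"
      using s' unfolding good_def by blast
    then have "s' ''path'' [i, Suc p] < n"
      using in_arcsD2 by auto
    then have "d (s' ''path'' [i, Suc p]) b = l"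
      using good gdist_tri[of q "s' ''path'' [i, Suc p]" b] gdist_arc[of q "s' ''path'' [i, Suc p]"] bq by simp
    with s' good show "(\<forall>is. is \<noteq> [i, Suc p] \<longrightarrow> s' ''path'' is = s ''path'' is) \<and>
        (q, s' ''path'' [i, Suc p]) \<in> parcs G \<and> d (s' ''path'' [i, Suc p]) b = l"
      by blast
  qed simp
qed

text \<open>As the distance to \<open>b\<close> drops by one per step, a row with
  \<open>d a b\<close> steps ends in \<open>b\<close> and is a shortest path. For \<open>m\<close>
  up to \<open>d a b\<close> the subtraction is exact.\<close>

definition path_upto :: "(nat list \<Rightarrow> nat) \<Rightarrow> nat \<Rightarrow> nat \<Rightarrow> nat \<Rightarrow> nat \<Rightarrow> bool" where
  "path_upto P i a b m \<longleftrightarrow> P [i, 0] = a \<and> (\<forall>j\<le>m. P [i, j] < n \<and> d (P [i, j]) b = d a b - j) \<and>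
    (\<forall>j<m. (P [i, j], P [i, Suc j]) \<in> parcs G)"

definition row_ok :: "(nat list \<Rightarrow> nat) \<Rightarrow> (nat list \<Rightarrow> nat) \<Rightarrow> nat \<Rightarrow> nat \<Rightarrow> nat \<Rightarrow> bool" where
  "row_ok P L i a b \<longleftrightarrow> L [i] = Suc (d a b) \<and> path_upto P i a b (d a b)"

lemma row_ok_cong: "row_ok P L i a b \<Longrightarrow> L' [i] = L [i] \<Longrightarrow> (\<And>j. P' [i, j] = P [i, j]) \<Longrightarrow> row_ok P' L' i a b"
  by (simp add: row_ok_def path_upto_def)

lemma runs_write_path:
  assumes s: "input_ok s" "dist_ok (s ''D'')" "s ''i'' [] = i" "s ''A'' [i] = a" "s ''B'' [i] = b"
    and ab: "a < n" "b < n"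
  shows "runs write_path s (1 + (1 + (1 + For_time n (For_time n 2)))) (\<lambda>s'.
    row_ok (s' ''path'') (s' ''len'') i a b \<and>
    (\<forall>i'. i' \<noteq> i \<longrightarrow> s' ''len'' [i'] = s ''len'' [i'] \<and> (\<forall>j. s' ''path'' [i', j] = s ''path'' [i', j])))"
  unfolding write_path_def
proof (rule runs_Seq, rule_tac[2] runs_Seq, rule_tac[3] runs_Seq)
  let ?s1 = "s(''path'' := (s ''path'')([i, 0] := a))"
  show "runs (Assign ''path'' [Var ''i'', N 0] (V ''A'' [Var ''i''])) s 1 (\<lambda>s'. s' = ?s1)"
    using s by (intro runs_Assign) simp
  fix s1 assume s1: "s1 = ?s1"
  let ?s2 = "upd s1 ''l'' (d a b)"
  show "runs (Assign ''l'' [] (V ''D'' [V ''A'' [Var ''i''], V ''B'' [Var ''i'']])) s1 1 (\<lambda>s'. s' = ?s2)"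
    using s ab by (intro runs_Assign) (simp add: s1 upd_def)
  fix s2 assume s2: "s2 = ?s2"
  let ?s3 = "s2(''len'' := (s2 ''len'')([i] := Suc (d a b)))"
  show "runs (Assign ''len'' [Var ''i''] (Plus (Var ''l'') (N 1))) s2 1 (\<lambda>s'. s' = ?s3)"
    using s by (intro runs_Assign) (simp add: s1 s2)
  fix s3 assume s3: "s3 = ?s3"
  have in3: "input_ok s3" "dist_ok (s3 ''D'')" "s3 ''B'' [i] = b" "s3 ''i'' [] = i" "s3 ''l'' [] = d a b"
    using s input_ok_cong[of s s3] by (simp_all add: s1 s2 s3)
  let ?c = "For ''w'' (Var ''n'') extend"
  let ?I = "\<lambda>p s'. path_upto (s' ''path'') i a b p \<and>
    (\<forall>i'. i' \<noteq> i \<longrightarrow> (\<forall>j. s' ''path'' [i', j] = s3 ''path'' [i', j]))"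
  have "runs (For ''p'' (Var ''l'') ?c) s3 (For_time (d a b) (For_time n 2)) (?I (d a b))"
  proof (rule runs_For'[where I = ?I])
    fix p s'
    assume s': "p < d a b" "?I p s'" "s' ''p'' [] = p" "\<And>y. y \<notin> wvars (For ''p'' (Var ''l'') ?c) \<Longrightarrow> s' y = s3 y"
    let ?q = "s' ''path'' [i, p]"
    have "?q < n" "d ?q b = Suc (d a b - Suc p)"
      using s'(1,2) by (auto simp: path_upto_def)
    then have "runs ?c s' (For_time n 2) (\<lambda>s''.
      (\<forall>is. is \<noteq> [i, Suc p] \<longrightarrow> s'' ''path'' is = s' ''path'' is) \<and>
      (?q, s'' ''path'' [i, Suc p]) \<in> parcs G \<and> d (s'' ''path'' [i, Suc p]) b = d a b - Suc p)"
      using in3 ab s' input_ok_cong[of s3 s'] by (intro runs_extend) simp_all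
    then show "runs ?c s' (For_time n 2) (\<lambda>s''. ?I (Suc p) (upd s'' ''p'' (Suc p)))"
    proof (rule runs_mono)
      fix s''
      assume s'': "(\<forall>is. is \<noteq> [i, Suc p] \<longrightarrow> s'' ''path'' is = s' ''path'' is) \<and>
        (?q, s'' ''path'' [i, Suc p]) \<in> parcs G \<and> d (s'' ''path'' [i, Suc p]) b = d a b - Suc p"
      then have "s'' ''path'' [i, Suc p] < n"
        using in_arcsD2 by auto
      then show "?I (Suc p) (upd s'' ''p'' (Suc p))"
        using s'(2) s'' by (auto simp: path_upto_def le_Suc_eq less_Suc_eq)
    qed simp
  next
    show "?I 0 (upd s3 ''p'' 0)"
      using ab by (simp add: path_upto_def s1 s2 s3)
  qed (use in3 in simp_all)
  then show "runs (For ''p'' (Var ''l'') ?c) s3 (For_time n (For_time n 2)) (\<lambda>s'.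
    row_ok (s' ''path'') (s' ''len'') i a b \<and>
    (\<forall>i'. i' \<noteq> i \<longrightarrow> s' ''len'' [i'] = s ''len'' [i'] \<and> (\<forall>j. s' ''path'' [i', j] = s ''path'' [i', j])))"
  proof (rule runs_mono[OF runs_frame])
    show "For_time (d a b) (For_time n 2) \<le> For_time n (For_time n 2)"
      unfolding For_time_def
      using gdist_less_card[of a b] ab by (intro add_left_mono mult_le_mono1) simp
  qed (auto simp: row_ok_def s1 s2 s3)
qed

lemma runs_write_paths:
  assumes s: "input_ok s" "dist_ok (s ''D'')"
    and AB: "\<And>i. i < k \<Longrightarrow> s ''A'' [i] < n \<and> s ''B'' [i] < n"
  shows "runs write_paths s (write_time n k)
    (\<lambda>s'. \<forall>i<k. row_ok (s' ''path'') (s' ''len'') i (s ''A'' [i]) (s ''B'' [i]))"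
  unfolding write_paths_def write_time_def
proof (rule runs_For'[where I = "\<lambda>j s'. \<forall>i<j. row_ok (s' ''path'') (s' ''len'') i (s ''A'' [i]) (s ''B'' [i])"])
  fix j s'
  assume s': "j < k" "\<forall>i<j. row_ok (s' ''path'') (s' ''len'') i (s ''A'' [i]) (s ''B'' [i])" "s' ''i'' [] = j"
    "\<And>y. y \<notin> wvars (For ''i'' (Var ''k'') write_path) \<Longrightarrow> s' y = s y"
  have "runs write_path s' (1 + (1 + (1 + For_time n (For_time n 2)))) (\<lambda>s''.
    row_ok (s'' ''path'') (s'' ''len'') j (s ''A'' [j]) (s ''B'' [j]) \<and>
    (\<forall>i'. i' \<noteq> j \<longrightarrow> s'' ''len'' [i'] = s' ''len'' [i'] \<and> (\<forall>l. s'' ''path'' [i', l] = s' ''path'' [i', l])))"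
    using s s' AB input_ok_cong[of s s'] by (intro runs_write_path) simp_all
  then show "runs write_path s' (1 + (1 + (1 + For_time n (For_time n 2))))
     (\<lambda>s''. \<forall>i<Suc j. row_ok (upd s'' ''i'' (Suc j) ''path'') (upd s'' ''i'' (Suc j) ''len'') i (s ''A'' [i]) (s ''B'' [i]))"
  proof (rule runs_mono)
    fix s''
    assume s'': "row_ok (s'' ''path'') (s'' ''len'') j (s ''A'' [j]) (s ''B'' [j]) \<and>
      (\<forall>i'. i' \<noteq> j \<longrightarrow> s'' ''len'' [i'] = s' ''len'' [i'] \<and> (\<forall>l. s'' ''path'' [i', l] = s' ''path'' [i', l]))"
    then have "row_ok (s'' ''path'') (s'' ''len'') i (s ''A'' [i]) (s ''B'' [i])" if "i < j" for i
      using row_ok_cong[of "s' ''path''" "s' ''len''" i _ _ "s'' ''len''" "s'' ''path''"] s'(2) that by simp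
    then show "\<forall>i<Suc j. row_ok (upd s'' ''i'' (Suc j) ''path'') (upd s'' ''i'' (Suc j) ''len'') i (s ''A'' [i]) (s ''B'' [i])"
      using s'' by (simp add: less_Suc_eq)
  qed simp
qed (use s in simp_all)

lemma output_row:
  assumes row: "row_ok (s ''path'') (s ''len'') i a b" and ab: "a < n" "b < n" and i: "i < k"
  shows "isometric_path G (output_paths k s ! i)" "hd (output_paths k s ! i) = a" "last (output_paths k s ! i) = b"
proof -
  let ?P = "output_paths k s ! i"
  have P: "?P = map (\<lambda>j. s ''path'' [i, j]) [0..<Suc (d a b)]"
    using row i by (simp add: output_paths_def row_ok_def del: upt_Suc)
  have up: "s ''path'' [i, 0] = a" "\<And>j. j \<le> d a b \<Longrightarrow> s ''path'' [i, j] < n \<and> d (s ''path'' [i, j]) b = d a b - j"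
    "\<And>j. j < d a b \<Longrightarrow> (s ''path'' [i, j], s ''path'' [i, Suc j]) \<in> parcs G"
    using row by (auto simp: row_ok_def path_upto_def)
  show hd: "hd ?P = a"
    using up(1) by (simp add: P hd_map del: upt_Suc)
  have "s ''path'' [i, d a b] = b"
    using up(2)[of "d a b"] ab gdist_eq_0 by simp
  then show last: "last ?P = b"
    by (simp add: P)
  have "vwalk ?P (with_proj G)"
    using up(2,3) by (auto simp: P vwalk_iff_nth simp del: upt_Suc)
  then show "isometric_path G ?P"
    using hd last by (intro isometric_pathI) (simp_all add: P)
qed

end


section \<open>The algorithm\<close>

definition geodesic_center :: com where
  "geodesic_center = Seq distances (Seq greedy (Seq pair_up write_paths))"

definition total_time :: "nat \<Rightarrow> nat \<Rightarrow> nat" where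
  "total_time n k = (For_time n (For_time n 1 + 1) + For_time n (For_time n (For_time n (For_time n 2)))) +
    (greedy_time n k + (pair_up_time n k + write_time n k))"

context gc_input
begin

lemma input_state_ok: "input_ok (input_state G k)"
  by (simp add: input_ok_def input_state_def)

text \<open>\<open>x\<close>, \<open>A\<close> and \<open>B\<close> are the intermediate arrays, and
  their properties are the hypotheses of \<open>approximation\<close>. The hyperbolicity constant
  does not occur, as the program does not know it.\<close>

lemma runs_geodesic_center:
  "runs geodesic_center (input_state G k) (total_time n k) (\<lambda>s. \<exists>x A B.
    greedy_sequence G 0 (2 * k) x \<and> pairing x A B \<and> stable_pairing G k A B \<and>
    feasible G k (output_paths k s) \<and>
    (\<forall>i<k. hd (output_paths k s ! i) = A i \<and> last (output_paths k s ! i) = B i))"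
  unfolding geodesic_center_def total_time_def
proof (rule runs_Seq[OF runs_frame[OF runs_distances[OF input_state_ok]]])
  fix s1
  assume "dist_ok (s1 ''D'') \<and> (\<forall>x. x \<notin> wvars distances \<longrightarrow> s1 x = input_state G k x)"
  then have s1: "input_ok s1" "dist_ok (s1 ''D'')"
    using input_ok_cong[OF input_state_ok, of s1] by simp_all
  show "runs (Seq greedy (Seq pair_up write_paths)) s1 (greedy_time n k + (pair_up_time n k + write_time n k))
    (\<lambda>s. \<exists>x A B. greedy_sequence G 0 (2 * k) x \<and> pairing x A B \<and> stable_pairing G k A B \<and>
      feasible G k (output_paths k s) \<and>
      (\<forall>i<k. hd (output_paths k s ! i) = A i \<and> last (output_paths k s ! i) = B i))"
  proof (rule runs_Seq[OF runs_frame[OF runs_greedy[OF s1]]])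
    fix s2 :: state
    let ?x = "\<lambda>j. s2 ''X'' [j]"
    assume "greedy_sequence G 0 (2 * k) ?x \<and> (\<forall>x. x \<notin> wvars greedy \<longrightarrow> s2 x = s1 x)"
    then have s2: "input_ok s2" "dist_ok (s2 ''D'')" "greedy_sequence G 0 (2 * k) ?x"
      using s1 input_ok_cong[of s1 s2] by simp_all
    then have x: "?x j < n" if "j < 2 * k" for j
      using that by (simp add: greedy_sequence_def)
    show "runs (Seq pair_up write_paths) s2 (pair_up_time n k + write_time n k)
      (\<lambda>s. \<exists>x A B. greedy_sequence G 0 (2 * k) x \<and> pairing x A B \<and> stable_pairing G k A B \<and>
        feasible G k (output_paths k s) \<and>
        (\<forall>i<k. hd (output_paths k s ! i) = A i \<and> last (output_paths k s ! i) = B i))"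
    proof (rule runs_Seq[OF runs_frame[OF runs_pair_up[OF s2(1,2) x]]])
      fix s3 :: state
      let ?A = "\<lambda>i. s3 ''A'' [i]" and ?B = "\<lambda>i. s3 ''B'' [i]"
      assume "(pairing ?x ?A ?B \<and> stable_pairing G k ?A ?B) \<and> (\<forall>x. x \<notin> wvars pair_up \<longrightarrow> s3 x = s2 x)"
      then have s3: "input_ok s3" "dist_ok (s3 ''D'')" "pairing ?x ?A ?B" "stable_pairing G k ?A ?B"
        using s2 input_ok_cong[of s2 s3] by simp_all
      then have AB: "?A i < n \<and> ?B i < n" if "i < k" for i
        using that by (simp add: pairing_def)
      show "runs write_paths s3 (write_time n k)
        (\<lambda>s. \<exists>x A B. greedy_sequence G 0 (2 * k) x \<and> pairing x A B \<and> stable_pairing G k A B \<and>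
          feasible G k (output_paths k s) \<and>
          (\<forall>i<k. hd (output_paths k s ! i) = A i \<and> last (output_paths k s ! i) = B i))"
      proof (rule runs_mono[OF runs_write_paths[OF s3(1,2) AB]])
        fix s :: state
        assume rows: "\<forall>i<k. row_ok (s ''path'') (s ''len'') i (?A i) (?B i)"
        have out: "isometric_path G (output_paths k s ! i) \<and> hd (output_paths k s ! i) = ?A i \<and>
            last (output_paths k s ! i) = ?B i" if "i < k" for i
          using output_row[of s i "?A i" "?B i"] rows AB[OF that] that by blast
        moreover have "length (output_paths k s) = k"
          by (simp add: output_paths_def)
        ultimately have "feasible G k (output_paths k s)"
          unfolding feasible_def by (metis in_set_conv_nth)
        with out s2(3) s3(3,4) show "\<exists>x A B. greedy_sequence G 0 (2 * k) x \<and> pairing x A B \<and>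
            stable_pairing G k A B \<and> feasible G k (output_paths k s) \<and>
            (\<forall>i<k. hd (output_paths k s ! i) = A i \<and> last (output_paths k s ! i) = B i)"
          by blast
      qed simp_all
    qed
  qed
qed

text \<open>Programs are deterministic, so the given run is the one described by
  \<open>runs_geodesic_center\<close>.\<close>

lemma geodesic_center_approximation:
  assumes "exec geodesic_center (input_state G k) t s" "hyperbolic \<delta> G" "\<delta> \<ge> 0"
  shows "feasible G k (output_paths k s) \<and>
    real (eccentricity G (output_paths k s)) \<le> real (opt_radius G k) + 10 * \<delta>"
proof -
  obtain x A B where "greedy_sequence G 0 (2 * k) x" "pairing x A B" "stable_pairing G k A B"
    "feasible G k (output_paths k s)"
    "\<And>i. i < k \<Longrightarrow> hd (output_paths k s ! i) = A i \<and> last (output_paths k s ! i) = B i"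
    using runs_geodesic_center exec_deterministic[OF assms(1)] unfolding runs_def by metis
  then show ?thesis
    using approximation[OF assms(2,3) k, of 0 x A B "output_paths k s"] n_pos
    by (simp add: pairing_def)
qed

end

lemma gc_input:
  assumes "gc_instance G k"
  shows "gc_input G k"
proof -
  interpret pair_graph G
    using assms by (simp add: gc_instance_def)
  show ?thesis
    by unfold_locales (use assms in \<open>simp_all add: gc_instance_def\<close>)
qed

section \<open>Polynomial bound on the running time\<close>

definition poly_bounded :: "(nat \<Rightarrow> nat \<Rightarrow> nat) \<Rightarrow> bool" where
  "poly_bounded f \<longleftrightarrow> (\<exists>p :: nat poly. \<forall>n k. f n k \<le> poly p (n + k))"

named_theorems poly_bounded_intros

lemma poly_bounded_const [poly_bounded_intros]: "poly_bounded (\<lambda>n k. c)"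
  unfolding poly_bounded_def by (rule exI[of _ "[:c:]"]) simp

lemma poly_bounded_vertices [poly_bounded_intros]: "poly_bounded (\<lambda>n k. n)"
  unfolding poly_bounded_def by (rule exI[of _ "[:0, 1:]"]) simp

lemma poly_bounded_paths [poly_bounded_intros]: "poly_bounded (\<lambda>n k. k)"
  unfolding poly_bounded_def by (rule exI[of _ "[:0, 1:]"]) simp

lemma poly_bounded_add [poly_bounded_intros]:
  assumes "poly_bounded f" "poly_bounded g"
  shows "poly_bounded (\<lambda>n k. f n k + g n k)"
proof -
  obtain p q where "\<And>n k. f n k \<le> poly p (n + k)" "\<And>n k. g n k \<le> poly q (n + k)"
    using assms unfolding poly_bounded_def by blast
  then show ?thesis
    unfolding poly_bounded_def by (intro exI[of _ "p + q"]) (simp add: add_mono)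
qed

lemma poly_bounded_mult [poly_bounded_intros]:
  assumes "poly_bounded f" "poly_bounded g"
  shows "poly_bounded (\<lambda>n k. f n k * g n k)"
proof -
  obtain p q where "\<And>n k. f n k \<le> poly p (n + k)" "\<And>n k. g n k \<le> poly q (n + k)"
    using assms unfolding poly_bounded_def by blast
  then show ?thesis
    unfolding poly_bounded_def by (intro exI[of _ "p * q"]) (simp add: mult_mono)
qed

lemma polynomial_time_geodesic_center: "polynomial_time geodesic_center"
proof -
  have "poly_bounded total_time"
    unfolding total_time_def[abs_def] greedy_time_def pair_up_time_def write_time_def For_time_def
    by (intro poly_bounded_intros)
  then obtain p where p: "total_time n k \<le> poly p (n + k)" for n k
    unfolding poly_bounded_def by blast
  have "\<exists>t s. exec geodesic_center (input_state G k) t s \<and> t \<le> poly p (card (pverts G) + k)"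
    if "gc_instance G k" for G k
    using gc_input.runs_geodesic_center[OF gc_input[OF that]] p[of "card (pverts G)" k] unfolding runs_def
    by (meson order_trans)
  then show ?thesis
    unfolding polynomial_time_def by blast
qed

theorem theorem1:
  shows "\<exists>(C::real) (c::com). \<forall>\<delta>::real. \<delta> \<ge> 0 \<longrightarrow>
    additive_approx_algorithm c {G. hyperbolic \<delta> G} (C * \<delta>)"
proof (intro exI allI impI)
  fix \<delta> :: real
  assume \<delta>: "\<delta> \<ge> 0"
  \<comment> \<open>The constant 10 and the program are chosen independently of
    \<open>\<delta>\<close>.\<close>
  show "additive_approx_algorithm geodesic_center {G. hyperbolic \<delta> G} (10 * \<delta>)"
    unfolding additive_approx_algorithm_def
  proof (intro conjI ballI allI impI)
    fix G k
    assume "G \<in> {G. hyperbolic \<delta> G}" and inst: "gc_instance G k"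
    obtain t s where "exec geodesic_center (input_state G k) t s"
      using polynomial_time_geodesic_center inst unfolding polynomial_time_def by blast
    with gc_input.geodesic_center_approximation[OF gc_input[OF inst] this _ \<delta>] \<open>G \<in> _\<close>
    show "\<exists>t s. exec geodesic_center (input_state G k) t s \<and> feasible G k (output_paths k s) \<and>
        real (eccentricity G (output_paths k s)) \<le> real (opt_radius G k) + 10 * \<delta>"
      by blast
  qed (rule polynomial_time_geodesic_center)
qed

end
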